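(* For each positive integer $t$, there exists a linear-time algorithm that, given any tree $T$ as input, computes the value $\alpha_t^{f}(T)$.
   Context: All graphs are finite and simple. For a positive integer $t$, a set $S\subseteq V(G)$ is a $t$-frugal independent set of a graph $G$ if $S$ is an independent set and every vertex of $G$ has at most $t$ neighbors in $S$. The $t$-frugal independence number $\alpha_t^f(G)$ is the maximum cardinality of a $t$-frugal independent set in $G$. *)

theory Defs
  imports "HOL-Library.Ramsey"
begin

section \<open>Finite simple graphs and trees\<close>

definition simple_graph :: "'a set \<Rightarrow> 'a set set \<Rightarrow> bool" where
  "simple_graph V E \<longleftrightarrow> finite V \<and> (\<forall>e\<in>E. e \<subseteq> V \<and> card e = 2)"

definition neighbours :: "'a set set \<Rightarrow> 'a \<Rightarrow> 'a set" where
  "neighbours E v = {u. {u, v} \<in> E}"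

definition walk :: "'a set \<Rightarrow> 'a set set \<Rightarrow> 'a list \<Rightarrow> bool" where
  "walk V E p \<longleftrightarrow> p \<noteq> [] \<and> set p \<subseteq> V \<and> successively (\<lambda>u v. {u, v} \<in> E) p"

definition connected_graph :: "'a set \<Rightarrow> 'a set set \<Rightarrow> bool" where
  "connected_graph V E \<longleftrightarrow>
     V \<noteq> {} \<and> (\<forall>u\<in>V. \<forall>v\<in>V. \<exists>p. walk V E p \<and> hd p = u \<and> last p = v)"

text \<open>A cycle is given by the list of its distinct vertices; the closing edge joins the last
  vertex to the first.\<close>

definition cycle :: "'a set \<Rightarrow> 'a set set \<Rightarrow> 'a list \<Rightarrow> bool" where
  "cycle V E p \<longleftrightarrow> walk V E p \<and> distinct p \<and> 3 \<le> length p \<and> {last p, hd p} \<in> E"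

definition tree :: "'a set \<Rightarrow> 'a set set \<Rightarrow> bool" where
  "tree V E \<longleftrightarrow> simple_graph V E \<and> connected_graph V E \<and> (\<nexists>p. cycle V E p)"


section \<open>Frugal independent sets\<close>

definition independent_set :: "'a set \<Rightarrow> 'a set set \<Rightarrow> 'a set \<Rightarrow> bool" where
  "independent_set V E S \<longleftrightarrow> S \<subseteq> V \<and> indep S E"

definition frugal_independent_set :: "nat \<Rightarrow> 'a set \<Rightarrow> 'a set set \<Rightarrow> 'a set \<Rightarrow> bool" where
  "frugal_independent_set t V E S \<longleftrightarrow>
     independent_set V E S \<and> (\<forall>v\<in>V. card (neighbours E v \<inter> S) \<le> t)"

definition frugal_independence_number :: "nat \<Rightarrow> 'a set \<Rightarrow> 'a set set \<Rightarrow> nat" where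
  "frugal_independence_number t V E = Max {card S | S. frugal_independent_set t V E S}"


section \<open>Random access machines\<close>

text \<open>
  The model of computation is the unit-cost random access machine with addition and (truncated)
  subtraction as its only arithmetic. A program is a finite list of instructions. The machine has
  registers, which instructions name directly, and a memory, which is addressed through registers;
  as a program mentions finitely many registers, only finitely many of them are in use. In
  \<open>Jump_pos r l\<close> the control moves to instruction \<open>l\<close> if register \<open>r\<close> is positive. The machine halts
  when the program counter leaves the program.
\<close>

datatype instr =
    Const nat nat
  | Add nat nat nat
  | Sub nat nat nat
  | Load nat nat
  | Store nat nat
  | Jump_pos nat nat

type_synonym program = "instr list"

datatype config = Config (pc: nat) (reg: "nat \<Rightarrow> nat") (mem: "nat \<Rightarrow> nat")

fun exec_instr :: "instr \<Rightarrow> config \<Rightarrow> config" where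
  "exec_instr (Const r c) (Config l R M) = Config (Suc l) (R(r := c)) M"
| "exec_instr (Add r s s') (Config l R M) = Config (Suc l) (R(r := R s + R s')) M"
| "exec_instr (Sub r s s') (Config l R M) = Config (Suc l) (R(r := R s - R s')) M"
| "exec_instr (Load r s) (Config l R M) = Config (Suc l) (R(r := M (R s))) M"
| "exec_instr (Store r s) (Config l R M) = Config (Suc l) R (M(R r := R s))"
| "exec_instr (Jump_pos r l') (Config l R M) = Config (if R r > 0 then l' else Suc l) R M"

definition halted :: "program \<Rightarrow> config \<Rightarrow> bool" where
  "halted P C \<longleftrightarrow> length P \<le> pc C"

definition step :: "program \<Rightarrow> config \<Rightarrow> config" where
  "step P C = (if halted P C then C else exec_instr (P ! pc C) C)"

definition initial_config :: "nat list \<Rightarrow> config" where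
  "initial_config xs = Config 0 (\<lambda>_. 0) (\<lambda>i. if i < length xs then xs ! i else 0)"

definition run :: "program \<Rightarrow> nat list \<Rightarrow> nat \<Rightarrow> config" where
  "run P xs k = (step P ^^ k) (initial_config xs)"

definition halts_within :: "program \<Rightarrow> nat list \<Rightarrow> nat \<Rightarrow> nat \<Rightarrow> bool" where
  "halts_within P xs T y \<longleftrightarrow> halted P (run P xs T) \<and> reg (run P xs T) 0 = y"

definition words_bounded :: "program \<Rightarrow> nat list \<Rightarrow> nat \<Rightarrow> bool" where
  "words_bounded P xs B \<longleftrightarrow> (\<forall>k i. reg (run P xs k) i \<le> B \<and> mem (run P xs k) i \<le> B)"

text \<open>
  A problem is a relation between inputs, written as lists of words, and answers. The size of an
  input is its number of words. Unit cost is only meaningful for words of logarithmic length, so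
  besides the linear bound on the number of steps we demand that all numbers occurring during the
  computation (in particular, all memory addresses) are polynomially bounded in the input size.
\<close>

definition solves_in_linear_time :: "program \<Rightarrow> (nat list \<times> nat) set \<Rightarrow> bool" where
  "solves_in_linear_time P Q \<longleftrightarrow>
     (\<exists>c d. \<forall>(xs, y)\<in>Q.
        halts_within P xs (c * length xs) y \<and> words_bounded P xs ((length xs + 1) ^ d))"


section \<open>Graphs as inputs\<close>

text \<open>
  A graph with vertex set \<open>{0..<n}\<close> is presented by \<open>n\<close>, the number of edges, and a list of all
  edges, each occurring exactly once, in any order and with its endpoints in either order.
\<close>

definition edge_list_of :: "'a set set \<Rightarrow> ('a \<times> 'a) list \<Rightarrow> bool" where
  "edge_list_of E es \<longleftrightarrow>
     distinct (map (\<lambda>(u, v). {u, v}) es) \<and> set (map (\<lambda>(u, v). {u, v}) es) = E"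

definition graph_input :: "nat \<Rightarrow> (nat \<times> nat) list \<Rightarrow> nat list" where
  "graph_input n es = n # length es # concat (map (\<lambda>(u, v). [u, v]) es)"

definition tree_problem :: "(nat set \<Rightarrow> nat set set \<Rightarrow> nat) \<Rightarrow> (nat list \<times> nat) set" where
  "tree_problem f =
     {(graph_input n es, f {0..<n} E) | n E es. tree {0..<n} E \<and> edge_list_of E es}"

end

theory Submission
  imports Defs
begin

text \<open>
  Root the tree at some vertex and classify its vertices from the leaves upwards. A vertex is
  \<^emph>\<open>good\<close> if none of its children is good or saturated, and it is \<^emph>\<open>saturated\<close> if at least \<open>t\<close> of
  its children are good. With \<open>g v\<close> for the number of good children of \<open>v\<close>, the optimum is the
  sum of \<open>min t (g v)\<close> over all vertices \<open>v\<close>, plus one if the root is good. This is what a dynamic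
  programme over the tree amounts to: within its subtree, having a vertex in the set gains at most
  one over leaving it out, and reserving room for its parent costs at most one, so one bit for each
  of the two replaces a table.

  For the lower bound, pick \<open>min t (g v)\<close> good children below every vertex, and the root if
  it is good. Two good vertices are never adjacent, and a vertex whose parent is picked is not
  saturated, so it has room for the parent besides all its good children
  (\<open>frugal_set_attaining\<close>). For the upper bound, every member of a frugal independent
  set other than a good root sends one unit of charge to a vertex: a good member to its parent, a
  member with a good child to itself, any other member to a saturated child. No vertex \<open>v\<close>
  receives more than \<open>min t (g v)\<close> (\<open>frugal_set_le\<close>).

  The machine needs neither adjacency lists nor a traversal order. For every vertex it stores the
  degree and the sum of its neighbours. A leaf is recognised by its degree, and its only
  neighbour is then the stored sum; deleting the leaf changes the entries of these two
  vertices only. The vertices are scanned in increasing order, and whenever a leaf is deleted the scan first looks at its former neighbour,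
  which is the only vertex that may have become a leaf. Hence the vertices already scanned are
  never leaves, and the total number of rounds is at most twice the number of vertices. When the
  scan ends no leaf is left, so by acyclicity no edge is left, and by connectivity only one vertex
  is left, the root. Each deleted vertex had its neighbour as parent, and all its children were
  deleted before it, so its counters were final by then (\<open>pruned_remove_leaf\<close>,
  \<open>pruned_complete\<close>).

  The program is verified through checkpoints, the configurations at the heads of its two loops:
  a bounded number of steps leads from one checkpoint to the next and decreases a measure that is
  initially linear. Between two checkpoints a word can only grow by a constant factor, since a
  single step at most doubles the largest word; therefore it suffices to bound the words at
  checkpoints (\<open>run_through_checkpoints\<close>).
\<close>

section \<open>The optimum of a labelled rooted tree\<close>

text \<open>
  The tree enters only through a parent map whose edges are exactly those of the graph, so that the
  neighbours of a vertex are its children and its parent. The labels are required to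
  satisfy their defining equations rather than being defined by recursion, since the machine
  provides them in this form.
\<close>
locale labelled_rooted_tree =
  fixes V :: "'a set" and E :: "'a set set" and r :: 'a and par :: "'a \<Rightarrow> 'a"
    and t :: nat and good :: "'a \<Rightarrow> bool" and G :: "'a \<Rightarrow> nat"
  assumes finite_V: "finite V"
    and r_in: "r \<in> V"
    and par_in: "v \<in> V - {r} \<Longrightarrow> par v \<in> V"
    and par_neq: "v \<in> V - {r} \<Longrightarrow> par v \<noteq> v"
    and edges: "E = {{v, par v} | v. v \<in> V - {r}}"
    and t_pos: "t > 0"
    and G_eq: "v \<in> V \<Longrightarrow> G v = card {c \<in> V - {r}. par c = v \<and> good c}"
    and good_iff: "v \<in> V \<Longrightarrow> good v \<longleftrightarrow> (\<forall>c\<in>V - {r}. par c = v \<longrightarrow> \<not> good c \<and> G c < t)"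
begin

definition children :: "'a \<Rightarrow> 'a set" where
  "children v = {c \<in> V - {r}. par c = v}"

lemma neighbours_eq:
  assumes "v \<in> V"
  shows "neighbours E v = children v \<union> (if v = r then {} else {par v})"
  using assms unfolding neighbours_def children_def edges by (auto simp: doubleton_eq_iff)

lemma children_subset: "children v \<subseteq> V - {r}"
  unfolding children_def by auto

lemma finite_children: "finite (children v)"
  using children_subset finite_V by (meson finite_Diff finite_subset)

lemma G_children: "v \<in> V \<Longrightarrow> G v = card {c \<in> children v. good c}"
  using G_eq[of v] by (simp add: children_def conj_assoc)

lemma good_children: "v \<in> V \<Longrightarrow> good v \<longleftrightarrow> (\<forall>c\<in>children v. \<not> good c \<and> G c < t)"
  using good_iff[of v] by (auto simp: children_def)

lemma finite_neighbours: "v \<in> V \<Longrightarrow> finite (neighbours E v)"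
  using finite_children by (simp add: neighbours_eq)

lemma child_edge:
  assumes "c \<in> children v"
  shows "{c, v} \<in> E \<and> c \<noteq> v"
proof -
  have c: "c \<in> V - {r}" "v = par c" using assms by (auto simp: children_def)
  then have "{c, v} \<in> E" unfolding edges by blast
  then show ?thesis using par_neq[OF c(1)] c(2) by metis
qed

text \<open>
  The discharging argument. A vertex \<open>u\<close> of \<open>S\<close> has no neighbour in \<open>S\<close>, so it is charged at most
  by itself, and then it has a good child. A vertex \<open>u\<close> outside \<open>S\<close> is charged by neighbours in
  \<open>S\<close> only, hence at most \<open>t\<close> times; its parent is among them only if \<open>u\<close> is saturated, and
  otherwise all the charge comes from good children.
\<close>
lemma frugal_set_le:
  assumes S: "frugal_independent_set t V E S"
  shows "card S \<le> (\<Sum>v\<in>V. min t (G v)) + (if good r then 1 else 0)"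
proof -
  have SV: "S \<subseteq> V"
    and ind: "\<And>x y. x \<in> S \<Longrightarrow> y \<in> S \<Longrightarrow> {x, y} \<in> E \<Longrightarrow> x = y"
    and frugal: "\<And>v. v \<in> V \<Longrightarrow> card (neighbours E v \<inter> S) \<le> t"
    using S by (auto simp: frugal_independent_set_def independent_set_def indep_def)
  have finS: "finite S" using SV finite_V by (rule finite_subset)
  define S' where "S' = (if good r then S - {r} else S)"
  \<comment> \<open>A member that is not good and has no good child has a saturated child, by the definition of good.\<close>
  define payer where "payer v =
    (if good v then par v else if G v > 0 then v else (SOME c. c \<in> children v \<and> G c \<ge> t))" for v
  have saturated_child: "payer v \<in> children v \<and> G (payer v) \<ge> t"
    if "v \<in> S'" "\<not> good v" "G v = 0" for v
  proof -
    have v: "v \<in> V" using that SV by (auto simp: S'_def split: if_splits)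
    have "{c \<in> children v. good c} = {}"
      using that v G_children finite_children by simp
    then have "\<exists>c. c \<in> children v \<and> G c \<ge> t"
      using that(2) good_children[OF v] by (auto simp: not_less)
    then show ?thesis
      using that unfolding payer_def by simp (rule someI_ex)
  qed
  have good_child: "v \<in> children (par v)" if "v \<in> S'" "good v" for v
    using that SV by (auto simp: S'_def children_def split: if_splits)
  have S'_sub: "S' \<subseteq> S" by (simp add: S'_def)
  have payer_in: "payer v \<in> V" if "v \<in> S'" for v
  proof (cases "good v")
    case True
    then have "v \<in> V - {r}" using that SV by (auto simp: S'_def split: if_splits)
    then show ?thesis using True par_in by (simp add: payer_def)
  next
    case nongood: False
    show ?thesis
    proof (cases "G v = 0")
      case True
      then show ?thesis using saturated_child[OF that nongood] children_subset by blast
    next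
      case False
      then have "payer v = v" using nongood by (simp add: payer_def)
      then show ?thesis using that S'_sub SV by auto
    qed
  qed
  have fibre: "card {v \<in> S'. payer v = u} \<le> min t (G u)" (is "card ?F \<le> _") if u: "u \<in> V" for u
  proof (cases "u \<in> S")
    case True
    have "v = u \<and> G u > 0" if "v \<in> S'" "payer v = u" for v
    proof -
      have "\<not> good v"
        using good_child[OF that(1)] that child_edge ind[of v u] True S'_sub
        by (auto simp: payer_def)
      moreover have "G v \<noteq> 0"
      proof
        assume "G v = 0"
        then have "u \<in> children v" using saturated_child that \<open>\<not> good v\<close> by blast
        then show False using child_edge ind[of u v] True that S'_sub by blast
      qed
      ultimately show ?thesis using that by (simp add: payer_def)
    qed
    then have sub: "?F \<subseteq> {u}" and pos: "?F \<noteq> {} \<longrightarrow> G u > 0" by auto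
    show ?thesis
    proof (cases "?F = {}")
      case True
      then show ?thesis by (simp only: card.empty le0)
    next
      case False
      then have "1 \<le> min t (G u)" using pos t_pos by simp
      moreover have "card ?F \<le> card {u}" using sub by (intro card_mono) simp_all
      ultimately show ?thesis by simp
    qed
  next
    case False
    have payers: "(good v \<and> v \<in> children u) \<or> (G u \<ge> t \<and> u \<in> children v)"
      if "v \<in> S'" "payer v = u" for v
    proof (cases "good v")
      case True
      then show ?thesis using good_child[of v] that by (simp add: payer_def)
    next
      case nongood: False
      have "G v = 0"
        using nongood that False S'_sub by (auto simp: payer_def split: if_splits)
      then show ?thesis using saturated_child[OF that(1) nongood] that by simp
    qed
    have "?F \<subseteq> neighbours E u \<inter> S"
    proof
      fix v assume v: "v \<in> ?F"
      then have "{v, u} \<in> E"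
        using payers[of v] child_edge by (auto simp: insert_commute)
      then show "v \<in> neighbours E u \<inter> S" using v S'_sub by (auto simp: neighbours_def)
    qed
    then have le_t: "card ?F \<le> t"
      using frugal[OF u] finite_neighbours[OF u]
      by (meson card_mono finite_Int le_trans)
    show ?thesis
    proof (cases "G u \<ge> t")
      case True
      then show ?thesis using le_t by simp
    next
      case False
      then have "?F \<subseteq> {c \<in> children u. good c}" using payers by auto
      then have "card ?F \<le> G u"
        using G_children[OF u] finite_children by (simp add: card_mono)
      then show ?thesis using le_t by simp
    qed
  qed
  have "card S' = card (\<Union>u\<in>V. {v \<in> S'. payer v = u})"
    using payer_in by (intro arg_cong[of _ _ card]) auto
  also have "\<dots> \<le> (\<Sum>u\<in>V. card {v \<in> S'. payer v = u})"
    by (rule card_UN_le[OF finite_V])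
  also have "\<dots> \<le> (\<Sum>u\<in>V. min t (G u))"
    by (rule sum_mono) (rule fibre)
  finally have "card S' \<le> (\<Sum>u\<in>V. min t (G u))" .
  moreover have "card S \<le> card S' + (if good r then 1 else 0)"
    using finS by (auto simp: S'_def card_Diff_singleton_if)
  ultimately show ?thesis by linarith
qed

text \<open>
  Every member of the set built here is good. As the children of a good vertex are not good, the
  set is independent, and a vertex with a member as parent has fewer than \<open>t\<close> good children.
\<close>
lemma frugal_set_attaining:
  "\<exists>S. frugal_independent_set t V E S
     \<and> card S = (\<Sum>v\<in>V. min t (G v)) + (if good r then 1 else 0)"
proof -
  have "\<exists>T. T \<subseteq> {c \<in> children v. good c} \<and> card T = min t (G v)" if "v \<in> V" for v
    by (metis G_children[OF that] min.cobounded2 obtain_subset_with_card_n)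
  then obtain T where T: "\<And>v. v \<in> V \<Longrightarrow> T v \<subseteq> {c \<in> children v. good c}"
    and card_T: "\<And>v. v \<in> V \<Longrightarrow> card (T v) = min t (G v)"
    by metis
  define top where "top = (if good r then {r} else {})"
  define S where "S = (\<Union>v\<in>V. T v) \<union> top"
  have S_good: "good v \<and> v \<in> V" if "v \<in> S" for v
    using that T children_subset r_in by (fastforce simp: S_def top_def split: if_splits)
  have child_nongood: "\<not> good c" if "c \<in> children v" "good v" "v \<in> V" for c v
    using that good_children by blast
  have "indep S E"
    unfolding indep_def
  proof (intro ballI impI notI)
    fix x y assume x: "x \<in> S" and y: "y \<in> S" and xy: "{x, y} \<in> E"
    then obtain v where v: "v \<in> V - {r}" "{x, y} = {v, par v}"
      by (auto simp: edges)
    then have "v \<in> children (par v)" by (simp add: children_def)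
    then show False
      using v child_nongood[of v "par v"] S_good[OF x] S_good[OF y]
      by (auto simp: doubleton_eq_iff)
  qed
  moreover have "card (neighbours E v \<inter> S) \<le> t" if v: "v \<in> V" for v
  proof -
    have inter_children: "children v \<inter> S \<subseteq> T v"
    proof
      fix c assume c: "c \<in> children v \<inter> S"
      then have "c \<notin> top" by (auto simp: children_def top_def)
      then obtain w where w: "w \<in> V" "c \<in> T w" using c by (auto simp: S_def)
      then have "w = v" using T[OF w(1)] c by (auto simp: children_def)
      then show "c \<in> T v" using w by simp
    qed
    have fin_T: "finite (T v)"
      using T[OF v] finite_children by (metis (no_types, lifting) finite_subset mem_Collect_eq subsetD subsetI)
    have card_children: "card (children v \<inter> S) \<le> min t (G v)"
      using card_mono[OF fin_T inter_children] card_T[OF v] by simp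
    show ?thesis
    proof (cases "v \<noteq> r \<and> par v \<in> S")
      case True
      then have "v \<in> children (par v)" using v by (simp add: children_def)
      then have "G v < t"
        using S_good[of "par v"] True good_children by blast
      moreover have "neighbours E v \<inter> S = insert (par v) (children v \<inter> S)"
        using True v by (auto simp: neighbours_eq)
      ultimately show ?thesis
        using card_children finite_children[of v] by (simp add: card_insert_if)
    next
      case False
      then have "neighbours E v \<inter> S = children v \<inter> S"
        using v by (auto simp: neighbours_eq)
      then show ?thesis using card_children by simp
    qed
  qed
  moreover have "card S = (\<Sum>v\<in>V. min t (G v)) + (if good r then 1 else 0)"
  proof -
    have fin: "finite (T v)" if "v \<in> V" for v
      using T[OF that] finite_children by (metis (no_types, lifting) finite_subset mem_Collect_eq subsetD subsetI)
    have "card (\<Union>v\<in>V. T v) = (\<Sum>v\<in>V. card (T v))"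
    proof (intro card_UN_disjoint finite_V ballI impI)
      show "T v \<inter> T w = {}" if "v \<in> V" "w \<in> V" "v \<noteq> w" for v w
        using T[OF that(1)] T[OF that(2)] that(3) by (auto simp: children_def)
    qed (rule fin)
    moreover have "(\<Union>v\<in>V. T v) \<inter> top = {}"
    proof -
      have "r \<notin> T v" if "v \<in> V" for v
        using T[OF that] by (auto simp: children_def)
      then show ?thesis by (auto simp: top_def)
    qed
    moreover have "finite (\<Union>v\<in>V. T v)" using fin finite_V by simp
    ultimately show ?thesis
      unfolding S_def by (subst card_Un_disjoint) (auto simp: top_def card_T)
  qed
  moreover have "S \<subseteq> V" using S_good by blast
  ultimately show ?thesis
    unfolding frugal_independent_set_def independent_set_def by blast
qed

lemma frugal_independence_number_eq:
  "frugal_independence_number t V E = (\<Sum>v\<in>V. min t (G v)) + (if good r then 1 else 0)"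
  unfolding frugal_independence_number_def
proof (rule Max_eqI)
  have "{card S | S. frugal_independent_set t V E S} \<subseteq> {..card V}"
    using finite_V by (auto simp: frugal_independent_set_def independent_set_def intro: card_mono)
  then show "finite {card S | S. frugal_independent_set t V E S}"
    by (rule finite_subset) simp
  obtain S where "frugal_independent_set t V E S"
    "card S = (\<Sum>v\<in>V. min t (G v)) + (if good r then 1 else 0)"
    using frugal_set_attaining by blast
  then show "(\<Sum>v\<in>V. min t (G v)) + (if good r then 1 else 0)
      \<in> {card S | S. frugal_independent_set t V E S}"
    by (intro CollectI exI[of _ S]) (rule conjI[OF sym])
next
  fix k assume "k \<in> {card S | S. frugal_independent_set t V E S}"
  then obtain S where "k = card S" "frugal_independent_set t V E S" by (elim CollectE exE conjE)
  then show "k \<le> (\<Sum>v\<in>V. min t (G v)) + (if good r then 1 else 0)"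
    using frugal_set_le[of S] by (simp only:)
qed

end

section \<open>Leaves of forests, degrees and neighbour sums\<close>
lemma neighbour_sym: "u \<in> neighbours F v \<longleftrightarrow> v \<in> neighbours F u"
  by (simp add: neighbours_def insert_commute)

lemma simple_graph_edgeD:
  assumes "simple_graph V E" "{u, v} \<in> E"
  shows "u \<in> V" "v \<in> V" "u \<noteq> v"
  using assms by (auto simp: simple_graph_def card_insert_if split: if_splits)

lemma simple_graph_edgeE:
  assumes "simple_graph V E" "e \<in> E"
  obtains u v where "e = {u, v}" "u \<in> V" "v \<in> V" "u \<noteq> v"
  using assms unfolding simple_graph_def by (metis card_2_iff insert_subset)

lemma finite_neighbours:
  assumes "simple_graph V E" "F \<subseteq> E"
  shows "finite (neighbours F v)" "neighbours F v \<subseteq> V"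
proof -
  show "neighbours F v \<subseteq> V"
    using assms simple_graph_edgeD(1)[OF assms(1)] by (auto simp: neighbours_def)
  then show "finite (neighbours F v)"
    using assms(1) finite_subset by (auto simp: simple_graph_def)
qed

lemma subset_walk: "walk V F p \<Longrightarrow> F \<subseteq> E \<Longrightarrow> walk V E p"
  unfolding walk_def by (auto elim: successively_mono)

lemma walk_Cons:
  assumes "walk V F (x # p)" "z \<in> V" "{z, x} \<in> F"
  shows "walk V F (z # x # p)"
  using assms by (simp add: walk_def)

text \<open>
  Consider a longest path. If its first vertex were not a leaf, it would have a second neighbour,
  which lies on the path by maximality and closes a cycle.
\<close>
lemma acyclic_has_leaf:
  assumes graph: "simple_graph V E" and acyclic: "\<nexists>p. cycle V E p"
    and FE: "F \<subseteq> E" and nonempty: "F \<noteq> {}"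
  shows "\<exists>v\<in>V. card (neighbours F v) = 1"
proof (rule ccontr)
  assume no_leaf: "\<not> ?thesis"
  define paths where "paths = {p. walk V F p \<and> distinct p \<and> 2 \<le> length p}"
  obtain e where "e \<in> F" using nonempty by blast
  moreover from this FE have "e \<in> E" by (rule rev_subsetD)
  ultimately obtain a b where ab: "{a, b} \<in> F" "a \<in> V" "b \<in> V" "a \<noteq> b"
    by (metis simple_graph_edgeE[OF graph])
  then have "[a, b] \<in> paths" by (simp add: paths_def walk_def)
  moreover have "\<forall>p. p \<in> paths \<longrightarrow> length p < card V + 1"
  proof (intro allI impI)
    fix p assume "p \<in> paths"
    then have "length p = card (set p)" "set p \<subseteq> V"
      by (auto simp: paths_def walk_def distinct_card)
    moreover have "finite V" using graph by (simp add: simple_graph_def)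
    ultimately show "length p < card V + 1" using card_mono[of V "set p"] by simp
  qed
  ultimately obtain p where p: "p \<in> paths" and longest: "\<And>q. q \<in> paths \<Longrightarrow> length q \<le> length p"
    using ex_has_greatest_nat[of "\<lambda>p. p \<in> paths" "[a, b]" length] by blast
  then have "\<exists>x y ps. p = x # y # ps"
    unfolding paths_def by (cases p; cases "tl p") auto
  then obtain x y ps where p_eq: "p = x # y # ps" by blast
  have xV: "x \<in> V" and xy: "{x, y} \<in> F" using p by (auto simp: p_eq paths_def walk_def)
  have "y \<in> neighbours F x" using xy by (simp add: neighbours_def insert_commute)
  moreover have "neighbours F x \<noteq> {y}" using no_leaf xV by auto
  ultimately obtain z where z: "z \<in> neighbours F x" "z \<noteq> y" by blast
  then have zx: "{z, x} \<in> F" by (simp add: neighbours_def)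
  then have zV: "z \<in> V" "z \<noteq> x" using simple_graph_edgeD[OF graph] FE by blast+
  have "z \<in> set p"
  proof (rule ccontr)
    assume "z \<notin> set p"
    then have "z # p \<in> paths"
      using p walk_Cons[of V F x "y # ps" z] zx zV by (simp add: paths_def p_eq)
    then show False using longest by fastforce
  qed
  then obtain qs rs where "ps = qs @ z # rs"
    using z(2) zV(2) split_list by (fastforce simp: p_eq)
  then have q: "p = (x # y # qs @ [z]) @ rs" by (simp add: p_eq)
  have "cycle V E (x # y # qs @ [z])"
    unfolding cycle_def
  proof (intro conjI)
    have "walk V F ((x # y # qs @ [z]) @ rs)" using p unfolding q by (simp add: paths_def)
    then have "walk V F (x # y # qs @ [z])"
      unfolding walk_def successively_append_iff by simp
    then show "walk V E (x # y # qs @ [z])" using FE by (rule subset_walk)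
    show "distinct (x # y # qs @ [z])" using p unfolding paths_def q by auto
    show "{last (x # y # qs @ [z]), hd (x # y # qs @ [z])} \<in> E" using zx FE by auto
  qed simp
  then show False using acyclic by blast
qed

text \<open>
  A crude bound that keeps the number of vertices linear in the input size: unless there is only
  one vertex, each vertex is an endpoint of an edge.
\<close>
lemma tree_card_le:
  assumes "tree V E"
  shows "card V \<le> 2 * card E + 2"
proof (cases "\<exists>x\<in>V. \<exists>y\<in>V. x \<noteq> y")
  case False
  have "card V \<le> 1"
  proof (cases "V = {}")
    case False
    then obtain x where "x \<in> V" by blast
    then have "V \<subseteq> {x}" using \<open>\<not> (\<exists>x\<in>V. \<exists>y\<in>V. x \<noteq> y)\<close> by blast
    then have "card V \<le> card {x}" by (intro card_mono) simp_all
    then show ?thesis by simp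
  qed simp
  then show ?thesis by simp
next
  case True
  have graph: "simple_graph V E" and conn: "connected_graph V E"
    using assms by (auto simp: tree_def)
  have "V \<subseteq> \<Union>E"
  proof
    fix x assume x: "x \<in> V"
    then obtain y where y: "y \<in> V" "x \<noteq> y" using True by blast
    then obtain p where p: "walk V E p" "hd p = x" "last p = y"
      using conn x by (auto simp: connected_graph_def)
    then obtain z ps where "p = x # z # ps"
      using y(2) by (cases p; cases "tl p") (auto simp: walk_def)
    then have "{x, z} \<in> E" using p by (simp add: walk_def)
    then show "x \<in> \<Union>E" by blast
  qed
  moreover have "finite E"
    using graph by (auto simp: simple_graph_def intro: finite_subset[of E "Pow V"])
  moreover have "finite (\<Union>E)"
    using graph \<open>finite E\<close> by (auto simp: simple_graph_def intro: finite_subset)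
  ultimately have "card V \<le> card (\<Union>E)" by (simp add: card_mono)
  also have "\<dots> \<le> sum card E" by (rule card_Union_le_sum_card) 
  also have "\<dots> = 2 * card E" using graph by (simp add: simple_graph_def)
  finally show ?thesis by simp
qed

text \<open>
  Degrees are tracked for all vertices, so that deleted ones (those in \<open>R\<close>) are never mistaken
  for leaves; the neighbour sum of a deleted vertex is not kept up to date.
\<close>
definition degree_and_sum :: "nat set \<Rightarrow> nat set set \<Rightarrow> nat set \<Rightarrow> (nat \<Rightarrow> nat) \<Rightarrow> (nat \<Rightarrow> nat) \<Rightarrow> bool" where
  "degree_and_sum V F R D S \<longleftrightarrow>
     (\<forall>v\<in>V. D v = card (neighbours F v)) \<and> (\<forall>v\<in>V - R. S v = \<Sum>(neighbours F v))"

lemma degree_and_sum_insert_edge: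
  assumes "simple_graph V E" "insert {a, b} F \<subseteq> E" "{a, b} \<notin> F"
    and "degree_and_sum V F {} D S"
  shows "degree_and_sum V (insert {a, b} F) {}
    (D(a := D a + 1, b := D b + 1)) (S(a := S a + b, b := S b + a))"
proof -
  have ab: "a \<in> V" "b \<in> V" "a \<noteq> b" using simple_graph_edgeD[OF assms(1), of a b] assms(2) by auto
  have "neighbours (insert {a, b} F) a = insert b (neighbours F a)"
    "neighbours (insert {a, b} F) b = insert a (neighbours F b)"
    "b \<notin> neighbours F a" "a \<notin> neighbours F b"
    using ab assms(3) by (auto simp: neighbours_def doubleton_eq_iff insert_commute)
  moreover have "neighbours (insert {a, b} F) v = neighbours F v" if "v \<noteq> a" "v \<noteq> b" for v
    using that by (auto simp: neighbours_def doubleton_eq_iff)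
  moreover have "finite (neighbours F v)" for v
    using finite_neighbours[OF assms(1)] assms(2) by simp
  ultimately show ?thesis
    using assms(4) ab by (auto simp: degree_and_sum_def)
qed

definition remaining :: "'a set set \<Rightarrow> 'a set \<Rightarrow> 'a set set" where
  "remaining E R = {e \<in> E. e \<inter> R = {}}"

lemma neighbours_remaining:
  "neighbours (remaining E R) v = (if v \<in> R then {} else neighbours E v - R)"
  by (auto simp: neighbours_def remaining_def)

text \<open>
  The neighbour sum of a leaf is its only neighbour, which is how the parent is found in constant
  time without adjacency lists.
\<close>
lemma degree_and_sum_remove_leaf:
  assumes graph: "simple_graph V E" and u: "u \<in> V" "D u = 1"
    and inv: "degree_and_sum V (remaining E R) R D S"
  defines "p \<equiv> S u"
  shows "neighbours (remaining E R) u = {p}" "u \<notin> R" "p \<notin> R" "p \<in> V" "p \<noteq> u" "{u, p} \<in> E"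
    and "degree_and_sum V (remaining E (insert u R)) (insert u R)
      (D(u := 0, p := D p - 1)) (S(p := S p - u))"
proof -
  let ?N = "neighbours (remaining E R)" and ?N' = "neighbours (remaining E (insert u R))"
  have fin: "finite (?N v)" for v
    using finite_neighbours[OF graph, of "remaining E R"] by (auto simp: remaining_def)
  have card_u: "card (?N u) = 1" using inv u by (simp add: degree_and_sum_def)
  then obtain q where q: "?N u = {q}" by (auto simp: card_1_singleton_iff)
  show uR: "u \<notin> R" using card_u by (auto simp: neighbours_remaining)
  then have "S u = \<Sum>(?N u)" using inv u by (simp add: degree_and_sum_def)
  then show Nu: "?N u = {p}" using q by (simp add: p_def)
  have "p \<in> ?N u" using Nu by simp
  then show "p \<notin> R" and up: "{u, p} \<in> E"
    by (auto simp: neighbours_def remaining_def insert_commute)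
  then show pV: "p \<in> V" and pu: "p \<noteq> u" using simple_graph_edgeD[OF graph] by blast+
  have "u \<in> ?N p" using Nu neighbour_sym[of u _ p] by simp
  then have "card (?N p - {u}) = card (?N p) - 1" "\<Sum>(?N p - {u}) = \<Sum>(?N p) - u"
    using fin by (simp_all add: sum_diff1_nat)
  moreover have "?N' v = ?N v" if "v \<noteq> u" "v \<noteq> p" for v
  proof -
    have "u \<notin> ?N v" using that(2) Nu neighbour_sym[of u _ v] by auto
    then show ?thesis using that(1) by (auto simp: neighbours_remaining)
  qed
  moreover have "?N' p = ?N p - {u}" using pu by (auto simp: neighbours_remaining)
  moreover have "?N' u = {}" by (simp add: neighbours_remaining)
  ultimately show "degree_and_sum V (remaining E (insert u R)) (insert u R)
      (D(u := 0, p := D p - 1)) (S(p := S p - u))"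
    using inv pu pV \<open>p \<notin> R\<close> by (auto simp: degree_and_sum_def)
qed

section \<open>Pruning a tree leaf by leaf\<close>

text \<open>
  Contracting each deleted vertex into an undeleted one witnesses that the undeleted part is still
  connected: once no edge is left there, the map is constant on every walk.
\<close>
definition retraction :: "nat set \<Rightarrow> nat set set \<Rightarrow> nat set \<Rightarrow> (nat \<Rightarrow> nat) \<Rightarrow> bool" where
  "retraction V E R f \<longleftrightarrow>
     (\<forall>v\<in>V. f v \<in> V - R) \<and> (\<forall>v\<in>V - R. f v = v) \<and>
     (\<forall>v w. {v, w} \<in> E \<longrightarrow> f v = f w \<or> {f v, f w} \<in> E)"

text \<open>
  The state after deleting the vertices in \<open>R\<close>, each of which received a parent when it was
  deleted. The labels are kept as numbers: \<open>G v\<close> counts the good children of \<open>v\<close>, and \<open>H v\<close> counts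
  those that are good or saturated. Thus \<open>c\<close> is good iff \<open>H c = 0\<close>. In truncated subtraction,
  \<open>1 - H c\<close> is the indicator of a good vertex, \<open>1 - (t - G c)\<close> that of a saturated one, and
  \<open>t - (t - k)\<close> is \<open>min t k\<close>, so the machine computes all of them without branching.
\<close>
definition pruned ::
  "nat \<Rightarrow> nat set \<Rightarrow> nat set set \<Rightarrow> nat set \<Rightarrow> (nat \<Rightarrow> nat) \<Rightarrow> (nat \<Rightarrow> nat) \<Rightarrow> (nat \<Rightarrow> nat) \<Rightarrow> nat \<Rightarrow> bool"
where
  "pruned t V E R par G H acc \<longleftrightarrow>
     R \<subseteq> V \<and>
     (\<forall>c\<in>R. par c \<in> V \<and> {c, par c} \<in> E) \<and>
     (\<forall>e\<in>E. e \<inter> R = {} \<or> (\<exists>c\<in>R. e = {c, par c})) \<and>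
     (\<exists>f. retraction V E R f) \<and>
     (\<forall>v\<in>V. G v = (\<Sum>c | c \<in> R \<and> par c = v. 1 - H c)) \<and>
     (\<forall>v\<in>V. H v = (\<Sum>c | c \<in> R \<and> par c = v. (1 - H c) + (1 - (t - G c)))) \<and>
     acc = (\<Sum>c\<in>R. t - (t - G c))"

lemma prunedD:
  assumes "pruned t V E R par G H acc"
  shows "R \<subseteq> V"
    and "c \<in> R \<Longrightarrow> par c \<in> V \<and> {c, par c} \<in> E"
    and "e \<in> E \<Longrightarrow> e \<inter> R = {} \<or> (\<exists>c\<in>R. e = {c, par c})"
    and "\<exists>f. retraction V E R f"
    and "v \<in> V \<Longrightarrow> G v = (\<Sum>c | c \<in> R \<and> par c = v. 1 - H c)"
    and "v \<in> V \<Longrightarrow> H v = (\<Sum>c | c \<in> R \<and> par c = v. (1 - H c) + (1 - (t - G c)))"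
    and "acc = (\<Sum>c\<in>R. t - (t - G c))"
  using assms unfolding pruned_def by blast+

lemma pruned_empty:
  "pruned t V E {} par (\<lambda>_. 0) (\<lambda>_. 0) 0"
  by (auto simp: pruned_def retraction_def intro!: exI[of _ id])

lemma pruned_bounds:
  assumes "pruned t V E R par G H acc" "finite V"
  shows "v \<in> V \<Longrightarrow> G v \<le> card V" "v \<in> V \<Longrightarrow> H v \<le> 2 * card V" "acc \<le> t * card V"
proof -
  have RV: "R \<subseteq> V" using assms(1) by (rule prunedD)
  then have fin: "finite R" using assms(2) finite_subset by blast
  have sub: "card {c \<in> R. par c = v} \<le> card V" for v
    using RV assms(2) by (auto intro: card_mono)
  show "G v \<le> card V" if "v \<in> V"
  proof -
    have "G v = (\<Sum>c | c \<in> R \<and> par c = v. 1 - H c)"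
      using prunedD(5)[OF assms(1) that] .
    also have "\<dots> \<le> (\<Sum>c | c \<in> R \<and> par c = v. 1)" by (intro sum_mono) simp
    finally show ?thesis using sub[of v] by simp
  qed
  show "H v \<le> 2 * card V" if "v \<in> V"
  proof -
    have "H v = (\<Sum>c | c \<in> R \<and> par c = v. (1 - H c) + (1 - (t - G c)))"
      using prunedD(6)[OF assms(1) that] .
    also have "\<dots> \<le> (\<Sum>c | c \<in> R \<and> par c = v. 2)" by (intro sum_mono) simp
    finally show ?thesis using sub[of v] by simp
  qed
  have "acc = (\<Sum>c\<in>R. t - (t - G c))" using assms(1) by (rule prunedD)
  also have "\<dots> \<le> (\<Sum>c\<in>R. t)" by (intro sum_mono) simp
  also have "\<dots> \<le> t * card V" using card_mono[OF assms(2) RV] by simp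
  finally show "acc \<le> t * card V" .
qed

text \<open>
  The new parent \<open>p\<close> is not deleted, so the labels of deleted vertices stay as they are and the
  equations for all vertices but \<open>p\<close> are unaffected.
\<close>
lemma pruned_remove_leaf:
  assumes inv: "pruned t V E R par G H acc"
    and graph: "simple_graph V E"
    and leaf: "neighbours (remaining E R) u = {p}" and u: "u \<in> V" "u \<notin> R"
  shows "pruned t V E (insert u R) (par(u := p))
    (G(p := G p + (1 - H u))) (H(p := H p + ((1 - H u) + (1 - (t - G u))))) (acc + (t - (t - G u)))"
    (is "pruned t V E ?R ?par ?G ?H ?acc")
proof -
  have "p \<in> neighbours (remaining E R) u" using leaf by simp
  then have up: "{u, p} \<in> E" and pR: "p \<notin> R"
    by (auto simp: neighbours_def remaining_def insert_commute)
  have pV: "p \<in> V" and pu: "p \<noteq> u" using simple_graph_edgeD[OF graph up] by auto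
  have RV: "R \<subseteq> V" using inv by (rule prunedD)
  have finR: "finite R" using RV graph finite_subset by (auto simp: simple_graph_def)
  have only_edge: "w = p" if "{u, w} \<in> E" "w \<notin> R" for w
  proof -
    have "w \<in> neighbours (remaining E R) u"
      using that u by (auto simp: neighbours_def remaining_def insert_commute)
    then show ?thesis using leaf by simp
  qed
  obtain f where "retraction V E R f"
    using prunedD(4)[OF inv] by blast
  then have f: "\<And>v. v \<in> V \<Longrightarrow> f v \<in> V - R" and f_id: "\<And>v. v \<in> V - R \<Longrightarrow> f v = v"
    and f_edge: "\<And>v w. {v, w} \<in> E \<Longrightarrow> f v = f w \<or> {f v, f w} \<in> E"
    by (auto simp: retraction_def)
  \<comment> \<open>Compose the retraction with moving the leaf to its only neighbour.\<close>
  define f' where "f' v = (if f v = u then p else f v)" for v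
  have f': "f' v \<in> V - ?R" if "v \<in> V" for v
    using f[OF that] pV pR pu by (auto simp: f'_def)
  have f'_edge: "f' v = f' w \<or> {f' v, f' w} \<in> E" if "{v, w} \<in> E" for v w
  proof -
    have "v \<in> V" "w \<in> V" using simple_graph_edgeD[OF graph that] by auto
    then show ?thesis
      using f_edge[OF that] f[of v] f[of w] only_edge[of "f w"] only_edge[of "f v"]
      by (auto simp: f'_def insert_commute)
  qed
  have GH_old: "?G c = G c" "?H c = H c" if "c \<in> ?R" for c
    using that pR pu by auto
  have kids: "{c. c \<in> ?R \<and> ?par c = v} =
      (if v = p then insert u {c. c \<in> R \<and> par c = v} else {c. c \<in> R \<and> par c = v})" for v
    using u pu by auto
  have kids_sum: "(\<Sum>c | c \<in> ?R \<and> ?par c = v. h c) =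
      (\<Sum>c | c \<in> R \<and> par c = v. h c) + (if v = p then h u else 0)" for v and h :: "nat \<Rightarrow> nat"
    unfolding kids using u finR by (simp add: add.commute)
  show ?thesis
    unfolding pruned_def
  proof (intro conjI ballI)
    show "?R \<subseteq> V" using u RV by simp
  next
    fix c assume c: "c \<in> ?R"
    show "?par c \<in> V" "{c, ?par c} \<in> E"
      using c prunedD(2)[OF inv, of c] pV up by auto
  next
    fix e assume e: "e \<in> E"
    show "e \<inter> ?R = {} \<or> (\<exists>c\<in>?R. e = {c, ?par c})"
    proof (cases "e \<inter> R = {}")
      case True
      show ?thesis
      proof (cases "u \<in> e")
        case True
        obtain a b where "e = {a, b}" using simple_graph_edgeE[OF graph e] by blast
        then obtain w where w: "e = {u, w}" using True by auto
        then have "w = p" using only_edge e \<open>e \<inter> R = {}\<close> by auto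
        then show ?thesis using w by simp
      next
        case False
        then show ?thesis using \<open>e \<inter> R = {}\<close> by auto
      qed
    next
      case False
      then obtain c where "c \<in> R" "e = {c, par c}" using prunedD(3)[OF inv e] by blast
      moreover from this have "c \<noteq> u" using u by auto
      ultimately show ?thesis by (intro disjI2 bexI[of _ c]) auto
    qed
  next
    have "f' v = v" if "v \<in> V - ?R" for v
      using that f_id[of v] by (auto simp: f'_def)
    then have "retraction V E ?R f'"
      using f' f'_edge by (simp add: retraction_def)
    then show "\<exists>f. retraction V E ?R f" by blast
  next
    fix v assume v: "v \<in> V"
    have "(\<Sum>c | c \<in> ?R \<and> ?par c = v. 1 - ?H c) = (\<Sum>c | c \<in> ?R \<and> ?par c = v. 1 - H c)"
      using GH_old by (intro sum.cong) simp_all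
    also have "\<dots> = G v + (if v = p then 1 - H u else 0)"
      unfolding kids_sum prunedD(5)[OF inv v] ..
    also have "\<dots> = ?G v" by simp
    finally show "?G v = (\<Sum>c | c \<in> ?R \<and> ?par c = v. 1 - ?H c)" ..
    have "(\<Sum>c | c \<in> ?R \<and> ?par c = v. (1 - ?H c) + (1 - (t - ?G c))) =
        (\<Sum>c | c \<in> ?R \<and> ?par c = v. (1 - H c) + (1 - (t - G c)))"
      using GH_old by (intro sum.cong) simp_all
    also have "\<dots> = H v + (if v = p then (1 - H u) + (1 - (t - G u)) else 0)"
      unfolding kids_sum prunedD(6)[OF inv v] ..
    also have "\<dots> = ?H v" by simp
    finally show "?H v = (\<Sum>c | c \<in> ?R \<and> ?par c = v. (1 - ?H c) + (1 - (t - ?G c)))" ..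
  next
    have "(\<Sum>c\<in>?R. t - (t - ?G c)) = (\<Sum>c\<in>?R. t - (t - G c))"
      using GH_old by (intro sum.cong) simp_all
    then show "?acc = (\<Sum>c\<in>?R. t - (t - ?G c))"
      using prunedD(7)[OF inv] u(2) finR by (simp add: add.commute)
  qed
qed

text \<open>
  Without leaves there are no edges left, hence only \<open>r\<close> is undeleted and the labels are those of
  the tree rooted at \<open>r\<close>.
\<close>
lemma pruned_complete:
  assumes tree: "tree V E" and t: "t > 0"
    and inv: "pruned t V E R par G H acc"
    and no_leaf: "\<And>v. v \<in> V \<Longrightarrow> card (neighbours (remaining E R) v) \<noteq> 1"
    and r: "r \<in> V" "r \<notin> R"
  shows "frugal_independence_number t V E = acc + (t - (t - G r)) + (1 - H r)"
proof -
  have graph: "simple_graph V E" and conn: "connected_graph V E" and acyclic: "\<nexists>p. cycle V E p"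
    using tree by (auto simp: tree_def)
  have finV: "finite V" using graph by (simp add: simple_graph_def)
  have RV: "R \<subseteq> V" using inv by (rule prunedD)
  have "remaining E R \<subseteq> E" by (auto simp: remaining_def)
  then have none: "remaining E R = {}"
    using acyclic_has_leaf[OF graph acyclic, of "remaining E R"] no_leaf by blast
  obtain f where "retraction V E R f"
    using prunedD(4)[OF inv] by blast
  then have f: "\<And>v. v \<in> V \<Longrightarrow> f v \<in> V - R" and f_id: "\<And>v. v \<in> V - R \<Longrightarrow> f v = v"
    and f_edge: "\<And>v w. {v, w} \<in> E \<Longrightarrow> f v = f w \<or> {f v, f w} \<in> E"
    by (auto simp: retraction_def)
  have fixed: "f v = f w" if "{v, w} \<in> E" for v w
  proof -
    have "v \<in> V" "w \<in> V" using simple_graph_edgeD[OF graph that] by auto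
    then have "{f v, f w} \<inter> R = {}" using f by blast
    then show ?thesis using f_edge[OF that] none by (auto simp: remaining_def)
  qed
  have walk_fixed: "f (hd p) = f (last p)" if "walk V E p" for p
    using that
  proof (induction p)
    case (Cons x p)
    show ?case
    proof (cases p)
      case (Cons y q)
      then have "{x, y} \<in> E" "walk V E p" using Cons.prems by (simp_all add: walk_def)
      then show ?thesis using fixed[of x y] Cons.IH Cons by simp
    qed simp
  qed (simp add: walk_def)
  have "V - R = {r}"
  proof (intro equalityI subsetI)
    fix x assume x: "x \<in> V - R"
    then obtain q where "walk V E q" "hd q = x" "last q = r"
      using conn r(1) by (auto simp: connected_graph_def)
    then have "f x = f r" using walk_fixed by blast
    then show "x \<in> {r}" using f_id[OF x] f_id[of r] r by simp
  next
    fix x assume "x \<in> {r}"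
    then show "x \<in> V - R" using r by simp
  qed
  then have R: "R = V - {r}" using RV by blast
  have par_R: "\<And>c. c \<in> R \<Longrightarrow> par c \<in> V \<and> {c, par c} \<in> E"
    and edge_R: "\<And>e. e \<in> E \<Longrightarrow> e \<inter> R = {} \<or> (\<exists>c\<in>R. e = {c, par c})"
    using prunedD(2,3)[OF inv] by blast+
  interpret labelled_rooted_tree V E r par t "\<lambda>v. H v = 0" G
  proof
    show "E = {{v, par v} |v. v \<in> V - {r}}"
    proof
      show "E \<subseteq> {{v, par v} |v. v \<in> V - {r}}"
      proof
        fix e assume e: "e \<in> E"
        then have "e \<inter> R \<noteq> {}" using none by (auto simp: remaining_def)
        then show "e \<in> {{v, par v} |v. v \<in> V - {r}}" using edge_R[OF e] R by blast
      qed
    qed (use par_R R in blast)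
    fix v assume v: "v \<in> V - {r}"
    then show "par v \<in> V" "par v \<noteq> v"
      using par_R[of v] R simple_graph_edgeD(3)[OF graph, of v "par v"] by auto
  next
    fix v assume v: "v \<in> V"
    have fin: "finite {c \<in> V - {r}. par c = v}" using finV by simp
    have "G v = (\<Sum>c | c \<in> V - {r} \<and> par c = v. 1 - H c)"
      using prunedD(5)[OF inv v] unfolding R .
    also have "\<dots> = (\<Sum>c\<in>{c \<in> V - {r}. par c = v}. if H c = 0 then 1 else 0)"
      by (intro sum.cong) auto
    also have "\<dots> = (\<Sum>c\<in>{c \<in> {c \<in> V - {r}. par c = v}. H c = 0}. 1)"
      by (rule sum.inter_filter[OF fin, symmetric])
    also have "\<dots> = card {c \<in> V - {r}. par c = v \<and> H c = 0}"
      by (simp only: card_eq_sum mem_Collect_eq conj_assoc)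
    finally show "G v = card {c \<in> V - {r}. par c = v \<and> H c = 0}" .
    have "H v = (\<Sum>c | c \<in> V - {r} \<and> par c = v. (1 - H c) + (1 - (t - G c)))"
      using prunedD(6)[OF inv v] unfolding R .
    then have "H v = 0 \<longleftrightarrow> (\<forall>c\<in>{c \<in> V - {r}. par c = v}. (1 - H c) + (1 - (t - G c)) = 0)"
      using fin by simp
    moreover have "(1 - x) + (1 - (t - y)) = 0 \<longleftrightarrow> x \<noteq> 0 \<and> y < t" for x y by auto
    ultimately show "(H v = 0) = (\<forall>c\<in>V - {r}. par c = v \<longrightarrow> H c \<noteq> 0 \<and> G c < t)"
      by (simp only:) blast
  qed (use finV r t in auto)
  have "V = insert r R" using R r by auto
  moreover have "acc = (\<Sum>c\<in>R. t - (t - G c))" using inv by (rule prunedD)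
  moreover have "min t k = t - (t - k)" for k by simp
  moreover have "finite R" using finV RV finite_subset by blast
  ultimately have "(\<Sum>v\<in>V. min t (G v)) = acc + (t - (t - G r))"
    using r(2) by simp
  then show ?thesis using frugal_independence_number_eq by simp
qed

section \<open>Running random access machines\<close>
definition bounded_by :: "nat \<Rightarrow> config \<Rightarrow> bool" where
  "bounded_by B C \<longleftrightarrow> (\<forall>i. reg C i \<le> B \<and> mem C i \<le> B)"

lemma halted_steps: "halted P C \<Longrightarrow> (step P ^^ k) C = C"
  by (induction k) (simp_all add: step_def)

definition constants_le :: "program \<Rightarrow> nat \<Rightarrow> bool" where
  "constants_le P B \<longleftrightarrow> (\<forall>r c. Const r c \<in> set P \<longrightarrow> c \<le> B)"

text \<open>
  Addition is the only instruction that creates a word larger than all present words and all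
  constants of the program, and it at most doubles.
\<close>
lemma step_bounded:
  assumes "constants_le P B" "B \<le> X" "bounded_by X C"
  shows "bounded_by (2 * X) (step P C)"
proof (cases "halted P C")
  case True
  then show ?thesis using assms(3) by (auto simp: step_def bounded_by_def intro: le_trans)
next
  case False
  obtain l R M where C: "C = Config l R M" by (cases C)
  have R: "R i \<le> X" and M: "M i \<le> X" for i using assms(3) by (auto simp: C bounded_by_def)
  have R2: "R i \<le> 2 * X" and M2: "M i \<le> 2 * X" and "R i + R j \<le> 2 * X" and "R i - R j \<le> 2 * X" for i j
    using R[of i] M[of i] R[of j] by linarith+
  moreover have "c \<le> 2 * X" if "P ! l = Const r c" for r c
  proof -
    have "Const r c \<in> set P" using False that nth_mem[of l P] by (simp add: C halted_def)
    then show ?thesis using assms(1,2) by (fastforce simp: constants_le_def)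
  qed
  ultimately show ?thesis
    using False by (cases "P ! l") (auto simp: C step_def bounded_by_def)
qed

lemma steps_bounded:
  assumes "constants_le P B" "bounded_by B C"
  shows "bounded_by (2 ^ k * B) ((step P ^^ k) C)"
proof (induction k)
  case (Suc k)
  then show ?case using step_bounded[OF assms(1), of "2 ^ k * B"] by (simp add: mult.assoc)
qed (use assms in simp)

text \<open>
  The invariant \<open>I\<close> describes the checkpoints and its first argument is a measure. Both
  resource bounds follow: the number of steps is at most \<open>K\<close> times the initial measure, and words
  exceed their bound at checkpoints at most by the constant factor \<open>2 ^ K\<close>.
\<close>
lemma run_through_checkpoints:
  assumes const: "constants_le P B"
    and bounded: "\<And>m C. I m C \<Longrightarrow> bounded_by B C"
    and progress: "\<And>m C. I m C \<Longrightarrow> \<not> halted P C \<Longrightarrow> \<exists>k\<le>K. \<exists>m'<m. I m' ((step P ^^ k) C)"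
    and start: "I m C"
  shows "\<exists>k m'. k \<le> K * m \<and> I m' ((step P ^^ k) C) \<and> halted P ((step P ^^ k) C)
    \<and> (\<forall>j. bounded_by (2 ^ K * B) ((step P ^^ j) C))"
  using start
proof (induction m arbitrary: C rule: less_induct)
  case (less m)
  have near: "bounded_by (2 ^ K * B) ((step P ^^ j) C)" if "j \<le> K" for j
  proof -
    have "2 ^ j * B \<le> 2 ^ K * B" using that by simp
    moreover have "bounded_by (2 ^ j * B) ((step P ^^ j) C)"
      using const bounded[OF less.prems] by (rule steps_bounded)
    ultimately show ?thesis unfolding bounded_by_def using le_trans by blast
  qed
  show ?case
  proof (cases "halted P C")
    case True
    then show ?thesis
      using less.prems near[of 0] by (intro exI[of _ 0] exI[of _ m]) (simp add: halted_steps)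
  next
    case False
    then obtain k m' where k: "k \<le> K" "m' < m" "I m' ((step P ^^ k) C)"
      using progress[OF less.prems] by blast
    let ?C = "(step P ^^ k) C"
    obtain k' m'' where k': "k' \<le> K * m'" "I m'' ((step P ^^ k') ?C)" "halted P ((step P ^^ k') ?C)"
      "\<And>j. bounded_by (2 ^ K * B) ((step P ^^ j) ?C)"
      using less.IH[OF k(2,3)] by blast
    have add: "(step P ^^ j) ?C = (step P ^^ (j + k)) C" for j by (simp add: funpow_add)
    have "bounded_by (2 ^ K * B) ((step P ^^ j) C)" for j
    proof (cases "j \<le> k")
      case True
      then show ?thesis using near k(1) by simp
    next
      case False
      then show ?thesis using k'(4)[of "j - k"] add[of "j - k"] by simp
    qed
    moreover have "k' + k \<le> K * m"
    proof -
      have "k' + k \<le> K * (m' + 1)" using k(1) k'(1) by simp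
      also have "\<dots> \<le> K * m" using k(2) by (intro mult_le_mono2) simp
      finally show ?thesis .
    qed
    ultimately show ?thesis
      using k'(2,3) unfolding add by (intro exI[of _ "k' + k"] exI[of _ m'']) simp
  qed
qed

text \<open>
  The last instruction of a block may be a jump; control is then wherever that jump leads, and
  executing the block is still a fold over its instructions.
\<close>
definition straight :: "program \<Rightarrow> bool" where
  "straight blk \<longleftrightarrow> (\<forall>i\<in>set (butlast blk). \<forall>r l. i \<noteq> Jump_pos r l)"

lemma steps_block:
  assumes "P = pre @ blk @ post" "straight blk" "l = length pre" "k = length blk"
  shows "(step P ^^ k) (Config l R M) = fold exec_instr blk (Config l R M)"
  using assms(1-3) unfolding assms(4)
proof (induction blk arbitrary: pre l R M)
  case (Cons i blk)
  have step: "step P (Config l R M) = exec_instr i (Config l R M)"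
    using Cons.prems by (simp add: step_def halted_def nth_append)
  show ?case
  proof (cases "blk = []")
    case True
    then show ?thesis using step by simp
  next
    case False
    then have i: "\<And>r l. i \<noteq> Jump_pos r l" and "straight blk"
      using Cons.prems(2) by (auto simp: straight_def)
    then obtain R' M' where i': "exec_instr i (Config l R M) = Config (Suc l) R' M'"
      by (cases i) auto
    have "(step P ^^ length blk) (Config (Suc l) R' M') = fold exec_instr blk (Config (Suc l) R' M')"
      using Cons.prems \<open>straight blk\<close> by (intro Cons.IH[of "pre @ [i]"]) simp_all
    then show ?thesis
      using step i' by (simp add: funpow_swap1)
  qed
qed simp

section \<open>The program\<close>

text \<open>
  Register 0 accumulates the answer, 1 holds the constant one, 2 the parameter \<open>t\<close>, 3 the number
  \<open>n\<close> of vertices. Registers 4 to 7 hold the start addresses of four arrays of length \<open>n\<close>, placed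
  behind the input: degrees, neighbour sums, and the labels \<open>G\<close> and \<open>H\<close>. Register 8 is the
  input position and later the scan position, 9 the current vertex, 10 the parent of the vertex
  deleted last (finally, the root), 11 to 14 are scratch, and 15 stays zero. As memory outside the
  input is zero initially, the arrays need no initialisation. The setup ends with a jump
  to the loop test at 31.
\<close>
definition setup_block :: "nat \<Rightarrow> program" where
  "setup_block t =
    [Const 1 1, Const 2 t, Load 3 0, Load 4 1, Add 4 4 1, Add 4 4 4,
     Add 5 4 3, Add 6 5 3, Add 7 6 3, Add 8 1 1, Jump_pos 1 31]"

text \<open>
  At 11: read one edge, increment the degree of both endpoints and add each endpoint to the
  neighbour sum of the other. Falls through to the test at 31, which jumps back while the input
  position is below the end of the input, that is, the start of the first array.
\<close>
definition edge_block :: program where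
  "edge_block =
    [Load 9 8, Add 8 8 1, Load 10 8, Add 8 8 1,
     Add 11 4 9, Load 12 11, Add 12 12 1, Store 11 12,
     Add 11 4 10, Load 12 11, Add 12 12 1, Store 11 12,
     Add 11 5 9, Load 12 11, Add 12 12 10, Store 11 12,
     Add 11 5 10, Load 12 11, Add 12 12 9, Store 11 12]"

definition edge_test_block :: program where
  "edge_test_block = [Sub 11 4 8, Jump_pos 11 11]"

definition start_block :: program where
  "start_block = [Const 8 0, Const 9 0, Const 10 0]"

text \<open>
  At 36: with degree \<open>d\<close> of the current vertex, \<open>(d - 1) + (1 - d)\<close> in truncated subtraction is
  positive iff \<open>d \<noteq> 1\<close>; then control moves to 74.
\<close>
definition leaf_test_block :: program where
  "leaf_test_block =
    [Add 11 4 9, Load 12 11, Sub 13 12 1, Sub 14 1 12, Add 13 13 14, Jump_pos 13 74]"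

text \<open>
  At 42: delete the current leaf and continue with its neighbour. By line: set the degree to zero;
  find the neighbour \<open>p\<close>; update the degree of \<open>p\<close>; update its neighbour sum; add the capped label
  \<open>G\<close> of the leaf to the answer and compute whether the leaf is saturated; compute whether it is
  good; update the label \<open>G\<close> of \<open>p\<close>; update its label \<open>H\<close>; return to 36.
\<close>
definition leaf_block :: program where
  "leaf_block =
    [Const 12 0, Store 11 12,
     Add 11 5 9, Load 10 11,
     Add 11 4 10, Load 12 11, Sub 12 12 1, Store 11 12,
     Add 11 5 10, Load 12 11, Sub 12 12 9, Store 11 12,
     Add 11 6 9, Load 12 11, Sub 13 2 12, Sub 14 2 13, Add 0 0 14, Sub 13 1 13,
     Add 11 7 9, Load 12 11, Sub 12 1 12,
     Add 11 6 10, Load 14 11, Add 14 14 12, Store 11 14,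
     Add 11 7 10, Load 14 11, Add 12 12 13, Add 14 14 12, Store 11 14,
     Add 9 10 15, Jump_pos 1 36]"

text \<open>
  At 74: the current vertex is no leaf, so the scan advances, and at the end control falls through
  to 78, where the contribution of the root is added.
\<close>
definition next_block :: program where
  "next_block = [Add 8 8 1, Add 9 8 15, Sub 11 3 8, Jump_pos 11 36]"

definition root_block :: program where
  "root_block =
    [Add 11 6 10, Load 12 11, Sub 13 2 12, Sub 13 2 13, Add 0 0 13,
     Add 11 7 10, Load 12 11, Sub 12 1 12, Add 0 0 12]"

definition frugal_program :: "nat \<Rightarrow> program" where
  "frugal_program t = setup_block t @ edge_block @ edge_test_block @ start_block @
     leaf_test_block @ leaf_block @ next_block @ root_block"

lemmas block_defs = setup_block_def edge_block_def edge_test_block_def start_block_def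
  leaf_test_block_def leaf_block_def next_block_def root_block_def

text \<open>
  \<open>L\<close> is the length of the input and \<open>Y\<close> bounds the memory words at checkpoints. Registers get
  twice as much room because a scratch register may hold the sum of two memory words.
\<close>
definition registers_ok :: "nat \<Rightarrow> nat \<Rightarrow> nat \<Rightarrow> nat \<Rightarrow> (nat \<Rightarrow> nat) \<Rightarrow> bool" where
  "registers_ok t n L Y R \<longleftrightarrow> R 1 = 1 \<and> R 2 = t \<and> R 3 = n \<and> R 4 = L \<and> R 5 = L + n
     \<and> R 6 = L + 2 * n \<and> R 7 = L + 3 * n \<and> R 15 = 0 \<and> (\<forall>i. R i \<le> 2 * Y)"

text \<open>
  Each block is located in the program by the number of instructions before it. Executing a block
  is then symbolic simplification of its fold.
\<close>
lemma steps_setup: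
  "(step (frugal_program t) ^^ 11) (Config 0 R M) = fold exec_instr (setup_block t) (Config 0 R M)"
  by (rule steps_block[where pre = "[]" and post = "edge_block @ edge_test_block @ start_block @ leaf_test_block @ leaf_block @ next_block @ root_block"])
    (simp_all add: frugal_program_def block_defs straight_def)

lemma steps_edge:
  "(step (frugal_program t) ^^ 20) (Config 11 R M) = fold exec_instr edge_block (Config 11 R M)"
  by (rule steps_block[where pre = "setup_block t" and post = "edge_test_block @ start_block @ leaf_test_block @ leaf_block @ next_block @ root_block"])
    (simp_all add: frugal_program_def block_defs straight_def)

lemma steps_edge_test:
  "(step (frugal_program t) ^^ 2) (Config 31 R M) = fold exec_instr edge_test_block (Config 31 R M)"
  by (rule steps_block[where pre = "setup_block t @ edge_block" and post = "start_block @ leaf_test_block @ leaf_block @ next_block @ root_block"])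
    (simp_all add: frugal_program_def block_defs straight_def)

lemma steps_start:
  "(step (frugal_program t) ^^ 3) (Config 33 R M) = fold exec_instr start_block (Config 33 R M)"
  by (rule steps_block[where pre = "setup_block t @ edge_block @ edge_test_block" and post = "leaf_test_block @ leaf_block @ next_block @ root_block"])
    (simp_all add: frugal_program_def block_defs straight_def)

lemma steps_leaf_test:
  "(step (frugal_program t) ^^ 6) (Config 36 R M) = fold exec_instr leaf_test_block (Config 36 R M)"
  by (rule steps_block[where pre = "setup_block t @ edge_block @ edge_test_block @ start_block" and post = "leaf_block @ next_block @ root_block"])
    (simp_all add: frugal_program_def block_defs straight_def)

lemma steps_leaf:
  "(step (frugal_program t) ^^ 32) (Config 42 R M) = fold exec_instr leaf_block (Config 42 R M)"
  by (rule steps_block[where pre = "setup_block t @ edge_block @ edge_test_block @ start_block @ leaf_test_block" and post = "next_block @ root_block"])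
    (simp_all add: frugal_program_def block_defs straight_def)

lemma steps_next:
  "(step (frugal_program t) ^^ 4) (Config 74 R M) = fold exec_instr next_block (Config 74 R M)"
  by (rule steps_block[where pre = "setup_block t @ edge_block @ edge_test_block @ start_block @ leaf_test_block @ leaf_block" and post = "root_block"])
    (simp_all add: frugal_program_def block_defs straight_def)

lemma steps_root:
  "(step (frugal_program t) ^^ 9) (Config 78 R M) = fold exec_instr root_block (Config 78 R M)"
  by (rule steps_block[where pre = "setup_block t @ edge_block @ edge_test_block @ start_block @ leaf_test_block @ leaf_block @ next_block" and post = "[]"])
    (simp_all add: frugal_program_def block_defs straight_def)

lemma setup_block_exec:
  assumes "M 0 = n" "2 * M 1 + 2 = L" "t \<le> Y" "L + 4 * n + 2 \<le> Y"
  shows "\<exists>R. fold exec_instr (setup_block t) (Config 0 (\<lambda>_. 0) M) = Config 31 R M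
     \<and> registers_ok t n L Y R \<and> R 0 = 0 \<and> R 8 = 2"
  using assms by (auto simp add: setup_block_def registers_ok_def)

lemma edge_test_block_exec:
  assumes "registers_ok t n L Y R" "L + 4 * n + 2 \<le> Y"
  shows "\<exists>R'. fold exec_instr edge_test_block (Config 31 R M) = Config (if R 8 < L then 11 else 33) R' M
     \<and> registers_ok t n L Y R' \<and> R' 0 = R 0 \<and> R' 8 = R 8"
  using assms by (auto simp add: edge_test_block_def registers_ok_def)

lemma edge_block_exec:
  assumes "registers_ok t n L Y R" "a = M (R 8)" "b = M (Suc (R 8))" "a < n" "b < n" "a \<noteq> b" "R 8 + 1 < L"
    and "\<And>i. M i \<le> Y" "L + 4 * n + 2 \<le> Y"
  shows "\<exists>R'. fold exec_instr edge_block (Config 11 R M) =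
      Config 31 R' (M(L + a := M (L + a) + 1, L + b := M (L + b) + 1,
        L + n + a := M (L + n + a) + b, L + n + b := M (L + n + b) + a))
     \<and> registers_ok t n L Y R' \<and> R' 0 = R 0 \<and> R' 8 = R 8 + 2"
proof -
  have "M i + M j \<le> 2 * Y" for i j
    using assms(8)[of i] assms(8)[of j] by linarith
  moreover have "a \<le> 2 * Y" "b \<le> 2 * Y" "L + n + b \<le> 2 * Y" "Suc (Suc (R 8)) \<le> 2 * Y"
    using assms(4-7,9) by linarith+
  ultimately show ?thesis
    using assms(1-7) by (simp add: edge_block_def registers_ok_def)
qed

lemma leaf_test_block_exec:
  assumes "registers_ok t n L Y R" "R 9 < n" "\<And>i. M i \<le> Y" "L + 4 * n + 2 \<le> Y"
  shows "\<exists>R'. fold exec_instr leaf_test_block (Config 36 R M) =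
      Config (if M (L + R 9) = 1 then 42 else 74) R' M
     \<and> registers_ok t n L Y R' \<and> R' 0 = R 0 \<and> R' 8 = R 8 \<and> R' 9 = R 9 \<and> R' 10 = R 10 \<and> R' 11 = L + R 9"
proof -
  have "M (L + R 9) \<le> 2 * Y" "M (L + R 9) - Suc 0 + (Suc 0 - M (L + R 9)) \<le> 2 * Y"
    "Suc 0 - M (L + R 9) \<le> 2 * Y" "L + R 9 \<le> 2 * Y"
    using assms(2,4) assms(3)[of "L + R 9"] by linarith+
  then show ?thesis
    using assms(1) by (auto simp add: leaf_test_block_def registers_ok_def)
qed

lemma leaf_block_exec:
  assumes "registers_ok t n L Y R" "u = R 9" "p = M (L + n + u)" "u < n" "p < n" "p \<noteq> u" "R 11 = L + u"
    and "\<And>i. M i \<le> Y" "L + 4 * n + 2 \<le> Y" "R 0 + t + 2 \<le> Y"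
  shows "\<exists>R'. fold exec_instr leaf_block (Config 42 R M) =
      Config 36 R' (M(L + u := 0, L + p := M (L + p) - 1, L + n + p := M (L + n + p) - u,
        L + 2 * n + p := M (L + 2 * n + p) + (1 - M (L + 3 * n + u)),
        L + 3 * n + p := M (L + 3 * n + p) + ((1 - M (L + 3 * n + u)) + (1 - (t - M (L + 2 * n + u))))))
     \<and> registers_ok t n L Y R' \<and> R' 0 = R 0 + (t - (t - M (L + 2 * n + u)))
     \<and> R' 8 = R 8 \<and> R' 9 = p \<and> R' 10 = p"
proof -
  have "M i + (Suc 0 - a + (Suc 0 - b)) \<le> 2 * Y" for i a b
    using assms(8)[of i] assms(9) by linarith
  moreover have "Suc 0 - a + (Suc 0 - b) \<le> 2 * Y" "Suc 0 - a \<le> 2 * Y" "R 0 + t - a \<le> 2 * Y" for a b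
    using assms(9,10) by linarith+
  moreover have "L + 3 * n + p \<le> 2 * Y" "p \<le> 2 * Y" "t - a \<le> 2 * Y" for a
    using assms(5,9,10) by linarith+
  ultimately show ?thesis
    using assms(1-7) by (simp add: leaf_block_def registers_ok_def)
qed

lemma next_block_exec:
  assumes "registers_ok t n L Y R" "R 8 < n" "L + 4 * n + 2 \<le> Y"
  shows "\<exists>R'. fold exec_instr next_block (Config 74 R M) = Config (if Suc (R 8) < n then 36 else 78) R' M
     \<and> registers_ok t n L Y R' \<and> R' 0 = R 0 \<and> R' 8 = Suc (R 8) \<and> R' 9 = Suc (R 8) \<and> R' 10 = R 10"
  using assms by (auto simp add: next_block_def registers_ok_def)

lemma root_block_exec:
  assumes "registers_ok t n L Y R" "p = R 10" "p < n" "L + 4 * n + 2 \<le> Y" "R 0 + t + 2 \<le> Y"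
  shows "\<exists>R'. fold exec_instr root_block (Config 78 R M) = Config 87 R' M
     \<and> (\<forall>i. R' i \<le> 2 * Y)
     \<and> R' 0 = R 0 + (t - (t - M (L + 2 * n + p))) + (1 - M (L + 3 * n + p))"
proof -
  have "R 0 + t + (Suc 0 - b) - a \<le> 2 * Y" "R 0 + t - a \<le> 2 * Y" "R 0 + (t - a) + (Suc 0 - b) \<le> 2 * Y"
    "Suc 0 - b \<le> 2 * Y" "L + 3 * n + p \<le> 2 * Y" "t - a \<le> 2 * Y" for a b
    using assms(3-5) by linarith+
  then show ?thesis
    using assms(1,2) by (simp add: root_block_def registers_ok_def)
qed

section \<open>The run on a tree\<close>
lemma degree_and_sum_cong:
  assumes "degree_and_sum V F R D S" "\<And>v. v \<in> V \<Longrightarrow> D' v = D v" "\<And>v. v \<in> V \<Longrightarrow> S' v = S v"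
  shows "degree_and_sum V F R D' S'"
  using assms by (simp add: degree_and_sum_def)

lemma degree_and_sum_bounds:
  assumes "degree_and_sum {0..<n} F {} D S" "simple_graph {0..<n} E" "F \<subseteq> E" "v < n"
  shows "D v \<le> n" "S v \<le> n * n"
proof -
  have N: "neighbours F v \<subseteq> {0..<n}" using finite_neighbours(2)[OF assms(2,3)] .
  then have card: "card (neighbours F v) \<le> n" using card_mono[OF _ N] by simp
  then show "D v \<le> n" using assms(1,4) by (simp add: degree_and_sum_def)
  have "S v = \<Sum>(neighbours F v)" using assms(1,4) by (simp add: degree_and_sum_def)
  also have "\<dots> \<le> card (neighbours F v) * n"
    using sum_bounded_above[of "neighbours F v" "\<lambda>w. w" n] N by force
  also have "\<dots> \<le> n * n" using card by simp
  finally show "S v \<le> n * n" .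
qed

lemma pruned_cong:
  assumes pruned: "pruned t V E R par G H acc"
    and "\<And>v. v \<in> V \<Longrightarrow> G' v = G v" "\<And>v. v \<in> V \<Longrightarrow> H' v = H v"
  shows "pruned t V E R par G' H' acc"
proof -
  have eq: "G' c = G c" "H' c = H c" if "c \<in> R" for c
    using assms(2,3) prunedD(1)[OF pruned] that by auto
  have "G' v = (\<Sum>c | c \<in> R \<and> par c = v. 1 - H' c)" if "v \<in> V" for v
  proof -
    have "(\<Sum>c | c \<in> R \<and> par c = v. 1 - H' c) = (\<Sum>c | c \<in> R \<and> par c = v. 1 - H c)"
      using eq by (intro sum.cong) simp_all
    then show ?thesis using prunedD(5)[OF pruned that] assms(2)[OF that] by simp
  qed
  moreover have "H' v = (\<Sum>c | c \<in> R \<and> par c = v. (1 - H' c) + (1 - (t - G' c)))" if "v \<in> V" for v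
  proof -
    have "(\<Sum>c | c \<in> R \<and> par c = v. (1 - H' c) + (1 - (t - G' c))) =
        (\<Sum>c | c \<in> R \<and> par c = v. (1 - H c) + (1 - (t - G c)))"
      using eq by (intro sum.cong) simp_all
    then show ?thesis using prunedD(6)[OF pruned that] assms(3)[OF that] by simp
  qed
  moreover have "acc = (\<Sum>c\<in>R. t - (t - G' c))"
    using prunedD(7)[OF pruned] eq by simp
  ultimately show ?thesis
    unfolding pruned_def using prunedD(1-4)[OF pruned] by blast
qed

lemma length_graph_input: "length (graph_input n es) = 2 * length es + 2"
  by (induction es) (auto simp: graph_input_def)

lemma graph_input_nth:
  assumes "k < length es"
  shows "graph_input n es ! (2 * k + 2) = fst (es ! k)" "graph_input n es ! (2 * k + 3) = snd (es ! k)"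
proof -
  have "concat (map (\<lambda>(u, v). [u, v]) es) ! (2 * k) = fst (es ! k)
      \<and> concat (map (\<lambda>(u, v). [u, v]) es) ! (2 * k + 1) = snd (es ! k)"
    using assms
  proof (induction es arbitrary: k)
    case (Cons e es)
    then show ?case by (cases k) (auto split: prod.splits)
  qed simp
  then show "graph_input n es ! (2 * k + 2) = fst (es ! k)" "graph_input n es ! (2 * k + 3) = snd (es ! k)"
    by (simp_all add: graph_input_def numeral_3_eq_3)
qed

locale tree_input =
  fixes t n :: nat and E :: "nat set set" and es :: "(nat \<times> nat) list"
  assumes t_pos: "t > 0" and tree: "tree {0..<n} E" and es: "edge_list_of E es"
begin

text \<open>
  The bound \<open>Y\<close> has to leave room for all array addresses, for neighbour sums, which are at most
  \<open>n * n\<close>, and for the answer, which is at most \<open>t * (n + 1)\<close>.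
\<close>
definition L :: nat where "L = 2 * length es + 2"
definition Y :: nat where "Y = (t + 8) * (L + 1)^2"
definition edges_read :: "nat \<Rightarrow> nat set set" where
  "edges_read k = set (take k (map (\<lambda>(u, v). {u, v}) es))"

lemma graph: "simple_graph {0..<n} E"
  using tree by (simp add: tree_def)

lemma n_pos: "0 < n"
  using tree by (auto simp: tree_def connected_graph_def)

lemma n_le: "n \<le> L"
proof -
  have "card E = length es"
    using es distinct_card unfolding edge_list_of_def by fastforce
  then show ?thesis using tree_card_le[OF tree] by (simp add: L_def)
qed

lemma room: "L + 4 * n + 2 \<le> Y" "t * n + t + 2 \<le> Y" "n * n \<le> Y" "2 * n \<le> Y" "t \<le> Y"
proof -
  define Q where "Q = (L + 1)^2"
  have Q: "L + 1 \<le> Q" "n * n \<le> Q" "n + 1 \<le> Q"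
    using n_le by (auto simp: Q_def power2_eq_square intro: mult_le_mono order_trans)
  have Y: "Y = t * Q + 8 * Q" by (simp add: Y_def Q_def algebra_simps)
  have "t * (n + 1) \<le> t * Q" using Q(3) by (rule mult_le_mono2)
  then show "L + 4 * n + 2 \<le> Y" "t * n + t + 2 \<le> Y" "n * n \<le> Y" "2 * n \<le> Y" "t \<le> Y"
    using Q n_le unfolding Y by (simp_all add: algebra_simps)
qed

lemma edges_read_Suc:
  assumes "k < length es" "es ! k = (a, b)"
  shows "edges_read (Suc k) = insert {a, b} (edges_read k)" "{a, b} \<notin> edges_read k"
    "edges_read k \<subseteq> E" "{a, b} \<in> E" "a < n" "b < n" "a \<noteq> b"
proof -
  let ?xs = "map (\<lambda>(u, v). {u, v}) es"
  have k: "k < length ?xs" "?xs ! k = {a, b}" using assms by simp_all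
  have d: "distinct ?xs" and s: "set ?xs = E" using es by (auto simp: edge_list_of_def)
  have take: "take (Suc k) ?xs = take k ?xs @ [{a, b}]"
    using take_Suc_conv_app_nth[OF k(1)] k(2) by simp
  show "edges_read (Suc k) = insert {a, b} (edges_read k)"
    unfolding edges_read_def take by simp
  have "distinct (take (Suc k) ?xs)" using d by (rule distinct_take)
  then show "{a, b} \<notin> edges_read k" unfolding edges_read_def take by simp
  show "edges_read k \<subseteq> E" unfolding edges_read_def s[symmetric] by (rule set_take_subset)
  show ab: "{a, b} \<in> E" using nth_mem[OF k(1)] k(2) s by simp
  then show "a < n" "b < n" "a \<noteq> b" using simple_graph_edgeD[OF graph ab] by auto
qed

lemma edges_read_all: "edges_read (length es) = E"
  using es by (simp add: edges_read_def edge_list_of_def)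

text \<open>
  The first loop, at its test. The label arrays are still untouched, which provides the zero labels
  for the start of the second loop.
\<close>
definition reading :: "nat \<Rightarrow> config \<Rightarrow> bool" where
  "reading k C \<longleftrightarrow> (\<exists>R M. C = Config 31 R M \<and> k \<le> length es \<and> registers_ok t n L Y R \<and>
     R 0 = 0 \<and> R 8 = 2 * k + 2 \<and> (\<forall>j<L. M j = graph_input n es ! j) \<and>
     (\<forall>j\<ge>L + 2 * n. M j = 0) \<and> (\<forall>j. M j \<le> Y) \<and>
     degree_and_sum {0..<n} (edges_read k) {} (\<lambda>v. M (L + v)) (\<lambda>v. M (L + n + v)))"

text \<open>
  The second loop, at its leaf test. Every vertex up to the scan position other than the
  current one is known not to be a leaf; the current vertex is exempt because it may just have lost
  a neighbour. The measure drops in each round, since either a vertex is deleted or the scan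
  advances.
\<close>
definition pruning :: "nat \<Rightarrow> config \<Rightarrow> bool" where
  "pruning m C \<longleftrightarrow> (\<exists>R M X par. C = Config 36 R M \<and> registers_ok t n L Y R \<and>
     R 8 < n \<and> R 9 < n \<and> R 10 < n \<and> R 10 \<notin> X \<and> (\<forall>j. M j \<le> Y) \<and>
     degree_and_sum {0..<n} (remaining E X) X (\<lambda>v. M (L + v)) (\<lambda>v. M (L + n + v)) \<and>
     pruned t {0..<n} E X par (\<lambda>v. M (L + 2 * n + v)) (\<lambda>v. M (L + 3 * n + v)) (R 0) \<and>
     (\<forall>w\<le>R 8. w \<noteq> R 9 \<longrightarrow> M (L + w) \<noteq> 1) \<and>
     m = (n - R 8) + (n - card X))"

text \<open>
  The number 87 is the length of the program, so the last case is the halted machine with its answer.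
\<close>
definition checkpoint :: "nat \<Rightarrow> config \<Rightarrow> bool" where
  "checkpoint m C \<longleftrightarrow>
     m = length es + 2 * n + 2 \<and> C = initial_config (graph_input n es) \<or>
     (\<exists>k. m = length es - k + 2 * n + 1 \<and> reading k C) \<or>
     pruning m C \<or>
     m = 0 \<and> pc C = 87 \<and> reg C 0 = frugal_independence_number t {0..<n} E \<and> bounded_by (2 * Y) C"

abbreviation prog :: program where "prog \<equiv> frugal_program t"

lemma initial_mem_le:
  "(if j < length (graph_input n es) then graph_input n es ! j else 0) \<le> L"
proof -
  have "x \<le> L" if "x \<in> set (graph_input n es)" for x
  proof -
    have "x = n \<or> x = length es \<or> (\<exists>u v. (u, v) \<in> set es \<and> (x = u \<or> x = v))"
      using that by (auto simp: graph_input_def)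
    then consider "x = n" | "x = length es" | u v where "(u, v) \<in> set es" "x = u \<or> x = v"
      by blast
    then show ?thesis
    proof cases
      case 3
      then obtain k where "k < length es" "es ! k = (u, v)" by (auto simp: in_set_conv_nth)
      then have "x < n" using edges_read_Suc[of k u v] 3(2) by auto
      then show ?thesis using n_le by simp
    qed (use n_le in \<open>simp_all add: L_def\<close>)
  qed
  then show ?thesis by simp
qed

lemma start_to_reading: "reading 0 ((step prog ^^ 11) (initial_config (graph_input n es)))"
proof -
  define M where "M = (\<lambda>j. if j < length (graph_input n es) then graph_input n es ! j else 0)"
  have M0: "M 0 = n" and M1: "2 * M 1 + 2 = L"
    by (simp_all add: M_def graph_input_def L_def)
  obtain R where R: "fold exec_instr (setup_block t) (Config 0 (\<lambda>_. 0) M) = Config 31 R M"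
    "registers_ok t n L Y R" "R 0 = 0" "R 8 = 2"
    using setup_block_exec[of M n L t Y, OF M0 M1 room(5) room(1)] by blast
  have zero: "M j = 0" if "L \<le> j" for j
    using that by (simp add: M_def length_graph_input L_def)
  have "degree_and_sum {0..<n} (edges_read 0) {} (\<lambda>v. M (L + v)) (\<lambda>v. M (L + n + v))"
    by (simp add: degree_and_sum_def edges_read_def neighbours_def zero)
  moreover have "M j \<le> Y" for j
    using initial_mem_le[of j] room(1) unfolding M_def by linarith
  ultimately have "reading 0 (Config 31 R M)"
    using R zero by (auto simp: reading_def M_def length_graph_input L_def)
  then show ?thesis
    using R(1) steps_setup[of t "\<lambda>_. 0" M] by (simp add: initial_config_def M_def)
qed

lemma reading_edge:
  assumes C: "reading k C" and k: "k < length es"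
  shows "reading (Suc k) ((step prog ^^ 22) C)"
proof -
  obtain R M where C_eq: "C = Config 31 R M" and ok: "registers_ok t n L Y R" and R0: "R 0 = 0"
    and R8: "R 8 = 2 * k + 2"
    and input: "\<And>j. j < L \<Longrightarrow> M j = graph_input n es ! j" and zero: "\<And>j. L + 2 * n \<le> j \<Longrightarrow> M j = 0"
    and M_le: "\<And>j. M j \<le> Y"
    and ds: "degree_and_sum {0..<n} (edges_read k) {} (\<lambda>v. M (L + v)) (\<lambda>v. M (L + n + v))"
    using C by (auto simp: reading_def)
  obtain a b where ab: "es ! k = (a, b)" by (cases "es ! k")
  note edge = edges_read_Suc[OF k ab]
  obtain R1 where R1: "fold exec_instr edge_test_block (Config 31 R M) = Config 11 R1 M"
    "registers_ok t n L Y R1" "R1 0 = 0" "R1 8 = 2 * k + 2"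
    using edge_test_block_exec[OF ok room(1), of M] k R0 R8 by (auto simp: L_def)
  have a: "a = M (R1 8)" and b: "b = M (Suc (R1 8))"
    using input[of "2 * k + 2"] input[of "2 * k + 3"] graph_input_nth[OF k, of n] k ab R1(4)
    by (simp_all add: L_def numeral_3_eq_3)
  define M' where "M' = M(L + a := M (L + a) + 1, L + b := M (L + b) + 1,
        L + n + a := M (L + n + a) + b, L + n + b := M (L + n + b) + a)"
  have "R1 8 + 1 < L" using R1(4) k by (simp add: L_def)
  then obtain R2 where R2: "fold exec_instr edge_block (Config 11 R1 M) = Config 31 R2 M'"
    "registers_ok t n L Y R2" "R2 0 = 0" "R2 8 = 2 * Suc k + 2"
    using edge_block_exec[OF R1(2) a b edge(5-7) _ M_le room(1)] R1(3,4) unfolding M'_def by auto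
  have "degree_and_sum {0..<n} (insert {a, b} (edges_read k)) {}
      ((\<lambda>v. M (L + v))(a := M (L + a) + 1, b := M (L + b) + 1))
      ((\<lambda>v. M (L + n + v))(a := M (L + n + a) + b, b := M (L + n + b) + a))"
    using edge(3,4) by (intro degree_and_sum_insert_edge[OF graph _ edge(2) ds]) simp
  then have ds': "degree_and_sum {0..<n} (edges_read (Suc k)) {} (\<lambda>v. M' (L + v)) (\<lambda>v. M' (L + n + v))"
    unfolding edge(1) by (rule degree_and_sum_cong) (use edge(5-7) in \<open>auto simp: M'_def\<close>)
  have sub: "edges_read (Suc k) \<subseteq> E" using edge(1,3,4) by simp
  have "M' (L + v) \<le> Y" "M' (L + n + v) \<le> Y" if "v < n" for v
    using degree_and_sum_bounds[OF ds' graph sub that] room(3,4) by linarith+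
  moreover have "M' j = M j" if "j \<noteq> L + a" "j \<noteq> L + b" "j \<noteq> L + n + a" "j \<noteq> L + n + b" for j
    using that by (simp add: M'_def)
  ultimately have M'_le: "M' j \<le> Y" for j
    using M_le[of j] edge(5,6) by metis
  have "reading (Suc k) (Config 31 R2 M')"
    using R2(2-4) k ds' M'_le input zero edge(5,6) by (auto simp: reading_def M'_def)
  moreover have "(step prog ^^ 22) C = (step prog ^^ 20) ((step prog ^^ 2) C)"
    by (simp flip: funpow_add[THEN fun_cong, unfolded o_apply])
  ultimately show ?thesis
    unfolding C_eq steps_edge_test R1(1) steps_edge R2(1) by simp
qed

lemma reading_done:
  assumes C: "reading (length es) C"
  shows "pruning (2 * n) ((step prog ^^ 5) C)"
proof -
  obtain R M where C_eq: "C = Config 31 R M" and ok: "registers_ok t n L Y R" and R0: "R 0 = 0"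
    and R8: "R 8 = 2 * length es + 2" and zero: "\<And>j. L + 2 * n \<le> j \<Longrightarrow> M j = 0"
    and M_le: "\<And>j. M j \<le> Y"
    and ds: "degree_and_sum {0..<n} E {} (\<lambda>v. M (L + v)) (\<lambda>v. M (L + n + v))"
    using C by (auto simp: reading_def edges_read_all)
  obtain R1 where R1: "fold exec_instr edge_test_block (Config 31 R M) = Config 33 R1 M"
    "registers_ok t n L Y R1" "R1 0 = 0"
    using edge_test_block_exec[OF ok room(1), of M] R0 R8 by (auto simp: L_def)
  define R2 where "R2 = R1(8 := 0, 9 := 0, 10 := 0)"
  have R2: "fold exec_instr start_block (Config 33 R1 M) = Config 36 R2 M"
    by (simp add: start_block_def R2_def)
  have "registers_ok t n L Y R2" "R2 0 = 0" "R2 8 = 0" "R2 9 = 0" "R2 10 = 0"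
    using R1(2,3) by (auto simp: registers_ok_def R2_def)
  moreover have "pruned t {0..<n} E {} id (\<lambda>v. M (L + 2 * n + v)) (\<lambda>v. M (L + 3 * n + v)) 0"
    by (rule pruned_cong[OF pruned_empty]) (simp_all add: zero)
  moreover have "remaining E {} = E" by (simp add: remaining_def)
  ultimately have "pruning (2 * n) (Config 36 R2 M)"
    unfolding pruning_def using n_pos M_le ds
    by (intro exI[of _ R2] exI[of _ M] exI[of _ "{}"] exI[of _ id]) simp
  moreover have "(step prog ^^ 5) C = (step prog ^^ 3) ((step prog ^^ 2) C)"
    by (simp flip: funpow_add[THEN fun_cong, unfolded o_apply])
  ultimately show ?thesis
    unfolding C_eq steps_edge_test R1(1) steps_start R2 by simp
qed

text \<open>
  The three ways from the leaf test back to a checkpoint: deletion of a leaf, advance of the scan,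
  and, when the scan is over, the final addition for the root. Fifty exceeds the length of each way.
\<close>
lemma pruning_step:
  assumes C: "pruning m C"
  shows "\<exists>k\<le>50. \<exists>m'<m. checkpoint m' ((step prog ^^ k) C)"
proof -
  obtain R M X par where C_eq: "C = Config 36 R M" and ok: "registers_ok t n L Y R"
    and v: "R 8 < n" and u: "R 9 < n" and r: "R 10 < n" "R 10 \<notin> X"
    and M_le: "\<And>j. M j \<le> Y"
    and ds: "degree_and_sum {0..<n} (remaining E X) X (\<lambda>v. M (L + v)) (\<lambda>v. M (L + n + v))"
    and pruned: "pruned t {0..<n} E X par (\<lambda>v. M (L + 2 * n + v)) (\<lambda>v. M (L + 3 * n + v)) (R 0)"
    and scanned: "\<And>w. w \<le> R 8 \<Longrightarrow> w \<noteq> R 9 \<Longrightarrow> M (L + w) \<noteq> 1"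
    and m: "m = (n - R 8) + (n - card X)"
    using C by (auto simp: pruning_def)
  have acc: "R 0 + t + 2 \<le> Y"
    using pruned_bounds(3)[OF pruned] room(2) by simp
  obtain R1 where R1: "fold exec_instr leaf_test_block (Config 36 R M) =
      Config (if M (L + R 9) = 1 then 42 else 74) R1 M"
    and ok1: "registers_ok t n L Y R1"
    and eq1: "R1 0 = R 0" "R1 8 = R 8" "R1 9 = R 9" "R1 10 = R 10" "R1 11 = L + R 9"
    using leaf_test_block_exec[where M = M, OF ok u M_le room(1)] by blast
  have steps6: "(step prog ^^ 6) C = Config (if M (L + R 9) = 1 then 42 else 74) R1 M"
    unfolding C_eq steps_leaf_test R1 ..
  have steps_after6: "(step prog ^^ (k + 6)) C = (step prog ^^ k) ((step prog ^^ 6) C)" for k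
    by (simp add: funpow_add)
  show ?thesis
  proof (cases "M (L + R 9) = 1")
    case leaf: True
    define u p where "u = R1 9" and "p = M (L + n + u)"
    have u_eq: "u = R 9" using eq1(3) by (simp add: u_def)
    have uV: "u \<in> {0..<n}" and leaf_u: "M (L + u) = 1" using u leaf by (simp_all add: u_eq)
    note removal = degree_and_sum_remove_leaf[OF graph uV leaf_u ds, folded p_def]
    have p: "p < n" "p \<noteq> u" "p \<notin> X" and uX: "u \<notin> X" using removal(2-5) by simp_all
    define M' where "M' = M(L + u := 0, L + p := M (L + p) - 1, L + n + p := M (L + n + p) - u,
        L + 2 * n + p := M (L + 2 * n + p) + (1 - M (L + 3 * n + u)),
        L + 3 * n + p := M (L + 3 * n + p) + ((1 - M (L + 3 * n + u)) + (1 - (t - M (L + 2 * n + u)))))"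
    define acc' where "acc' = R 0 + (t - (t - M (L + 2 * n + u)))"
    have u_n: "u < n" using uV by simp
    have "R1 11 = L + u" "R1 0 + t + 2 \<le> Y" using eq1 acc by (simp_all add: u_eq)
    then obtain R2 where R2: "fold exec_instr leaf_block (Config 42 R1 M) = Config 36 R2 M'"
      and ok2: "registers_ok t n L Y R2" and eq2: "R2 0 = acc'" "R2 8 = R 8" "R2 9 = p" "R2 10 = p"
      using leaf_block_exec[where M = M, OF ok1 u_def p_def u_n p(1,2) _ M_le room(1)] eq1
      unfolding M'_def acc'_def by auto
    have ds': "degree_and_sum {0..<n} (remaining E (insert u X)) (insert u X)
        (\<lambda>v. M' (L + v)) (\<lambda>v. M' (L + n + v))"
      by (rule degree_and_sum_cong[OF removal(7)]) (use p u_n in \<open>auto simp: M'_def\<close>)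
    have pruned': "pruned t {0..<n} E (insert u X) (par(u := p))
        (\<lambda>v. M' (L + 2 * n + v)) (\<lambda>v. M' (L + 3 * n + v)) acc'"
      unfolding acc'_def
      by (rule pruned_cong[OF pruned_remove_leaf[OF pruned graph removal(1) uV uX]])
        (use p u_n in \<open>auto simp: M'_def\<close>)
    have "M' (L + 2 * n + p) \<le> Y" "M' (L + 3 * n + p) \<le> Y"
      using pruned_bounds(1,2)[OF pruned', of p] p(1) room(1,4) by simp_all
    moreover have "M' j \<le> Y" if "j \<noteq> L + 2 * n + p" "j \<noteq> L + 3 * n + p" for j
    proof -
      have "M (L + p) - 1 \<le> Y" "M (L + n + p) - u \<le> Y"
        using M_le[of "L + p"] M_le[of "L + n + p"] by linarith+
      then show ?thesis using that M_le[of j] by (simp add: M'_def)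
    qed
    ultimately have M'_le: "M' j \<le> Y" for j by metis
    have scanned': "M' (L + w) \<noteq> 1" if "w \<le> R 8" "w \<noteq> p" for w
    proof (cases "w = u")
      case True
      then show ?thesis using p u_n by (simp add: M'_def)
    next
      case False
      then have "M' (L + w) = M (L + w)" using that v by (simp add: M'_def)
      then show ?thesis using scanned[of w] that(1) False u_eq by simp
    qed
    have XV: "insert u X \<subseteq> {0..<n}" using prunedD(1)[OF pruned'] .
    then have "finite (insert u X)" by (rule finite_subset) simp
    then have "card (insert u X) = Suc (card X)" using uX by simp
    moreover have "card (insert u X) \<le> n" using card_mono[OF _ XV] by simp
    ultimately have less: "(n - R 8) + (n - card (insert u X)) < m" unfolding m by linarith
    have "p \<notin> insert u X" using p by simp
    then have "pruning ((n - R 8) + (n - card (insert u X))) (Config 36 R2 M')"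
      unfolding pruning_def using ok2 eq2 v p(1) M'_le ds' pruned' scanned'
      by (intro exI[of _ R2] exI[of _ M'] exI[of _ "insert u X"] exI[of _ "par(u := p)"]) simp
    moreover have "(step prog ^^ (32 + 6)) C = Config 36 R2 M'"
      unfolding steps_after6 steps6 using leaf by (simp only: simp_thms if_True steps_leaf R2)
    ultimately have "checkpoint ((n - R 8) + (n - card (insert u X))) ((step prog ^^ (32 + 6)) C)"
      unfolding checkpoint_def by simp
    then show ?thesis using less by (intro exI[of _ "32 + 6"]) auto
  next
    case no_leaf: False
    obtain R2 where R2: "fold exec_instr next_block (Config 74 R1 M) =
        Config (if Suc (R 8) < n then 36 else 78) R2 M"
      and ok2: "registers_ok t n L Y R2"
      and eq2: "R2 0 = R 0" "R2 8 = Suc (R 8)" "R2 9 = Suc (R 8)" "R2 10 = R 10"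
      using next_block_exec[OF ok1 _ room(1), of M] v eq1 by auto
    have scanned': "M (L + w) \<noteq> 1" if "w \<le> R 8" for w
      using scanned[OF that] no_leaf by metis
    have steps10: "(step prog ^^ (4 + 6)) C = Config (if Suc (R 8) < n then 36 else 78) R2 M"
      unfolding steps_after6 steps6 using no_leaf by (simp only: simp_thms if_False steps_next R2)
    show ?thesis
    proof (cases "Suc (R 8) < n")
      case True
      have "pruning ((n - Suc (R 8)) + (n - card X)) (Config 36 R2 M)"
        unfolding pruning_def using ok2 eq2 True r M_le ds pruned scanned'
        by (intro exI[of _ R2] exI[of _ M] exI[of _ X] exI[of _ par]) simp
      then have "checkpoint ((n - Suc (R 8)) + (n - card X)) ((step prog ^^ (4 + 6)) C)"
        unfolding checkpoint_def steps10 using True by simp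
      moreover have "(n - Suc (R 8)) + (n - card X) < m" using v unfolding m by linarith
      ultimately show ?thesis by (intro exI[of _ "4 + 6"]) auto
    next
      case False
      then have all_scanned: "M (L + w) \<noteq> 1" if "w < n" for w using scanned'[of w] that by simp
      define r where "r = R2 10"
      have r': "r \<in> {0..<n}" "r \<notin> X" "r < n" using r eq2 by (simp_all add: r_def)
      have "R2 0 + t + 2 \<le> Y" using acc eq2 by simp
      then obtain R3 where R3: "fold exec_instr root_block (Config 78 R2 M) = Config 87 R3 M"
        and R3_le: "\<And>i. R3 i \<le> 2 * Y"
        and R3_0: "R3 0 = R 0 + (t - (t - M (L + 2 * n + r))) + (1 - M (L + 3 * n + r))"
        using root_block_exec[OF ok2 r_def r'(3) room(1)] eq2 by auto
      have "card (neighbours (remaining E X) w) \<noteq> 1" if "w \<in> {0..<n}" for w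
        using ds all_scanned[of w] that by (simp add: degree_and_sum_def)
      then have "R3 0 = frugal_independence_number t {0..<n} E"
        unfolding R3_0 using pruned_complete[OF tree t_pos pruned _ r'(1,2)] by simp
      moreover have "bounded_by (2 * Y) (Config 87 R3 M)"
        using R3_le M_le by (auto simp: bounded_by_def intro: order_trans[of _ Y])
      moreover have "(step prog ^^ (9 + (4 + 6))) C = Config 87 R3 M"
        unfolding funpow_add[of 9] o_apply steps10 using False by (simp only: simp_thms if_False steps_root R3)
      ultimately have "checkpoint 0 ((step prog ^^ (9 + (4 + 6))) C)"
        unfolding checkpoint_def by simp
      moreover have "0 < m" using v by (simp add: m)
      ultimately show ?thesis by (intro exI[of _ "9 + (4 + 6)"]) auto
    qed
  qed
qed

lemma length_prog: "length prog = 87"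
  by (simp add: frugal_program_def block_defs)

lemma checkpoint_step:
  assumes C: "checkpoint m C" and running: "\<not> halted prog C"
  shows "\<exists>k\<le>50. \<exists>m'<m. checkpoint m' ((step prog ^^ k) C)"
  using C unfolding checkpoint_def[of m C]
proof (elim disjE exE conjE)
  assume "m = length es + 2 * n + 2" "C = initial_config (graph_input n es)"
  moreover from this have "checkpoint (length es + 2 * n + 1) ((step prog ^^ 11) C)"
    unfolding checkpoint_def using start_to_reading by (intro disjI2 disjI1 exI[of _ 0]) simp
  ultimately show ?thesis by (intro exI[of _ 11]) auto
next
  fix k assume k: "m = length es - k + 2 * n + 1" "reading k C"
  then have "k \<le> length es" by (auto simp: reading_def)
  then consider "k < length es" | "k = length es" by linarith
  then show ?thesis
  proof cases
    case 1
    then have "checkpoint (length es - Suc k + 2 * n + 1) ((step prog ^^ 22) C)"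
      unfolding checkpoint_def using reading_edge[OF k(2)] by blast
    moreover have "length es - Suc k + 2 * n + 1 < m" using 1 k(1) by simp
    ultimately show ?thesis by (intro exI[of _ 22]) auto
  next
    case 2
    then have "checkpoint (2 * n) ((step prog ^^ 5) C)"
      unfolding checkpoint_def using reading_done k(2) by blast
    moreover have "2 * n < m" using k(1) by simp
    ultimately show ?thesis by (intro exI[of _ 5]) auto
  qed
next
  assume "pruning m C"
  then show ?thesis by (rule pruning_step)
next
  assume "pc C = 87"
  then show ?thesis using running by (simp add: halted_def length_prog)
qed

lemma checkpoint_bounded:
  assumes "checkpoint m C"
  shows "bounded_by (2 * Y) C"
  using assms unfolding checkpoint_def
proof (elim disjE exE conjE)
  assume C: "C = initial_config (graph_input n es)"
  have "L \<le> 2 * Y" using room(1) by simp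
  then show ?thesis
    using initial_mem_le unfolding C bounded_by_def initial_config_def
    by (simp only: config.sel) (meson le0 le_trans)
next
  fix k assume "reading k C"
  then obtain R M where "C = Config 31 R M" "\<forall>i. R i \<le> 2 * Y" "\<forall>j. M j \<le> Y"
    by (auto simp: reading_def registers_ok_def)
  then show ?thesis by (auto simp: bounded_by_def intro: order_trans[of _ Y])
next
  assume "pruning m C"
  then obtain R M where "C = Config 36 R M" "\<forall>i. R i \<le> 2 * Y" "\<forall>j. M j \<le> Y"
    by (auto simp: pruning_def registers_ok_def)
  then show ?thesis by (auto simp: bounded_by_def intro: order_trans[of _ Y])
qed

lemma constants_le_prog: "constants_le prog (2 * Y)"
proof -
  have "t \<le> 2 * Y" "1 \<le> 2 * Y" using room(1,5) by linarith+
  then show ?thesis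
    by (auto simp: constants_le_def frugal_program_def block_defs)
qed

lemma run_checkpoints:
  obtains k where "k \<le> 50 * (3 * L)" "halted prog (run prog (graph_input n es) k)"
    "reg (run prog (graph_input n es) k) 0 = frugal_independence_number t {0..<n} E"
    "\<And>j. bounded_by (2 ^ 50 * (2 * Y)) (run prog (graph_input n es) j)"
proof -
  let ?C = "initial_config (graph_input n es)"
  have start: "checkpoint (length es + 2 * n + 2) ?C" by (simp add: checkpoint_def)
  have "\<exists>k m'. k \<le> 50 * (length es + 2 * n + 2) \<and> checkpoint m' ((step prog ^^ k) ?C)
    \<and> halted prog ((step prog ^^ k) ?C) \<and> (\<forall>j. bounded_by (2 ^ 50 * (2 * Y)) ((step prog ^^ j) ?C))"
    by (rule run_through_checkpoints[where I = checkpoint, OF constants_le_prog _ _ start])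
      (fact checkpoint_bounded checkpoint_step)+
  then obtain k m' where k: "k \<le> 50 * (length es + 2 * n + 2)" "checkpoint m' ((step prog ^^ k) ?C)"
    "halted prog ((step prog ^^ k) ?C)" "\<And>j. bounded_by (2 ^ 50 * (2 * Y)) ((step prog ^^ j) ?C)"
    by blast
  have "reg ((step prog ^^ k) ?C) 0 = frugal_independence_number t {0..<n} E"
    using k(2) unfolding checkpoint_def
  proof (elim disjE exE conjE)
    assume "(step prog ^^ k) ?C = ?C"
    then show ?thesis using k(3) by (simp add: initial_config_def halted_def length_prog)
  next
    fix i assume "reading i ((step prog ^^ k) ?C)"
    then show ?thesis using k(3) by (auto simp: reading_def halted_def length_prog)
  next
    assume "pruning m' ((step prog ^^ k) ?C)"
    then show ?thesis using k(3) by (auto simp: pruning_def halted_def length_prog)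
  qed
  moreover have "length es + 2 * n + 2 \<le> 3 * L" using n_le by (simp add: L_def)
  then have "k \<le> 50 * (3 * L)" using k(1) by (meson le_trans mult_le_mono2)
  ultimately show ?thesis using that k(3,4) unfolding run_def by blast
qed

end

text \<open>
  The edge loop has one round per edge and the pruning loop at most two rounds per vertex, each of at
  most 50 steps; an input of \<open>L\<close> words has fewer than \<open>L / 2\<close> edges and at most \<open>L\<close> vertices,
  which gives \<open>150 * L\<close> steps.
\<close>
theorem theorem2p2:
  fixes t :: nat
  assumes "t > 0"
  shows "\<exists>P. solves_in_linear_time P (tree_problem (frugal_independence_number t))"
proof -
  \<comment> \<open>The factor of the word bound that depends on \<open>t\<close> alone is absorbed by the exponent, because
    inputs have at least two words.\<close>
  define e :: nat where "e = 2 ^ 50 * (2 * (t + 8))"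
  have "halts_within (frugal_program t) xs (150 * length xs) y
      \<and> words_bounded (frugal_program t) xs ((length xs + 1) ^ (e + 2))"
    if xy: "(xs, y) \<in> tree_problem (frugal_independence_number t)" for xs y
  proof -
    obtain n E es where xs: "xs = graph_input n es" and y: "y = frugal_independence_number t {0..<n} E"
      and "tree {0..<n} E" "edge_list_of E es"
      using xy unfolding tree_problem_def by blast
    then interpret tree_input t n E es using assms by unfold_locales
    have len: "length xs = L" by (simp add: xs length_graph_input L_def)
    obtain k where k: "k \<le> 50 * (3 * L)" "halted prog (run prog xs k)" "reg (run prog xs k) 0 = y"
      and bounded: "\<And>j. bounded_by (2 ^ 50 * (2 * Y)) (run prog xs j)"
      using run_checkpoints unfolding xs y by metis
    have "run prog xs (150 * length xs) = (step prog ^^ (150 * L - k + k)) (initial_config xs)"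
      using k(1) by (simp add: run_def len)
    also have "\<dots> = run prog xs k"
      using halted_steps[OF k(2)] unfolding funpow_add o_apply run_def .
    finally have "halts_within prog xs (150 * length xs) y"
      using k(2,3) by (simp add: halts_within_def)
    moreover have "2 ^ 50 * (2 * Y) \<le> (length xs + 1) ^ (e + 2)"
    proof -
      have "e \<le> 2 ^ e" using less_exp[of e] by simp
      also have "\<dots> \<le> (L + 1) ^ e" by (intro power_mono) (simp_all add: L_def)
      finally have "e * (L + 1)^2 \<le> (L + 1) ^ e * (L + 1)^2" by (rule mult_le_mono1)
      moreover have "2 ^ 50 * (2 * Y) = e * (L + 1)^2" by (simp add: e_def Y_def algebra_simps)
      ultimately show ?thesis by (simp only: len power_add)
    qed
    then have "words_bounded prog xs ((length xs + 1) ^ (e + 2))"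
      using bounded unfolding words_bounded_def bounded_by_def by (meson le_trans)
    ultimately show ?thesis ..
  qed
  then show ?thesis unfolding solves_in_linear_time_def by blast
qed

end
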